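(* Let $X,Y$ be real Hilbert spaces, $C\in\mathcal L(X,Y)$, and let $(A(t))_{t\ge 0}$ be a family of operators on $X$ with common dense domain $D$ satisfying the standing assumptions of the context, generating the evolution system $(\mathbb T(t,s))_{0\le s\le t}$. Let $\mu\ge 0$, assume that $((A(t))_{t\ge0},C)$ is $\mu$-weakly detectable, and let $r>\mu$. Let $(\mathbb S(t,s))_{0\le s\le t}$ be the evolution system generated by $(A(t)-rC^*C)_{t\ge0}$. Assume that there exist an increasing sequence of positive numbers $(t_n)_{n\ge0}$ with $t_n\to+\infty$ and an evolution system $(\mathbb T_\infty(t,s))_{0\le s\le t}$ on $X$ such that for all $\tau\ge0$, $$\|\mathbb T(t_n+t,t_n)-\mathbb T_\infty(t,0)\|_{\mathcal L(X)}\to 0\ \text{ as } n\to+\infty,\ \text{ uniformly in } t\in[0,\tau].$$ Let $\mathcal O$ be the observable subspace of the pair $(\mathbb T_\infty,C)$ and $\Pi_{\mathcal O}$ the orthogonal projection of $X$ onto $\mathcal O$. Then for all $\varepsilon_0\in X$, $\Pi_{\mathcal O}\,\mathbb S(t_n,0)\varepsilon_0$ converges weakly to $0$ in $X$ as $n\to+\infty$. Moreover, if $(t_{n+1}-t_n)_{n\ge0}$ is bounded and $\mathcal O=X$, then the Luenberger observer is a weak asymptotic observer, i.e. for all $\varepsilon_0\in X$, $\mathbb S(t,0)\varepsilon_0$ converges weakly to $0$ in $X$ as $t\to+\infty$.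
   Context: $\mathcal L(X,Y)$ denotes bounded linear operators, $\mathcal L(X)=\mathcal L(X,X)$; $C^*\in\mathcal L(Y,X)$ is the adjoint of $C$. Standing assumptions: $D\subset X$ is a dense subspace; for every $t\ge0$, $A(t):D\to X$ generates a strongly continuous semigroup on $X$; the family is stable (in Pazy's sense): there are $M\ge1$, $\omega\in\mathbb R$ such that $(\omega,\infty)\subset\rho(A(t))$ for all $t$ and $\|\prod_{j=1}^k (\lambda-A(t_j))^{-1}\|\le M(\lambda-\omega)^{-k}$ for all $\lambda>\omega$ and all finite sequences $0\le t_1\le\dots\le t_k$ (time-ordered product); for every $x\in D$, $t\mapsto A(t)x$ is continuously differentiable in $X$. An evolution system $(U(t,s))_{0\le s\le t}$ on $X$ is a family in $\mathcal L(X)$ with $U(s,s)=\mathrm{Id}$, $U(t,\sigma)U(\sigma,s)=U(t,s)$ for $s\le \sigma\le t$, and $(t,s)\mapsto U(t,s)x$ continuous for every $x\in X$. Under the standing assumptions (Pazy, Chapter 5, Theorem 4.8) $(A(t))$ generates a unique evolution system $\mathbb T$: for $x\in D$, $U(t,s)x\in D$, $\partial_tU(t,s)x=A(t)U(t,s)x$ and $\partial_sU(t,s)x=-U(t,s)A(s)x$; and $\|\mathbb T(t,s)\|\le Me^{\omega(t-s)}$ for some constants $M,\omega>0$. Likewise $(A(t)-rC^*C)_{t\ge0}$ generates a unique evolution system $\mathbb S$ (depending on $r$). System: $\dot z=A(t)z$, $z(0)=z_0$, $y=Cz$. Luenberger observer: $\dot{\hat z}=A(t)\hat z-rC^*(C\hat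 z-y)$, $\hat z(0)=\hat z_0$. The error $\varepsilon=\hat z-z$ is $\varepsilon(t)=\mathbb S(t,0)\varepsilon_0$, $\varepsilon_0=\hat z_0-z_0$. $((A(t))_{t\ge0},C)$ is $\mu$-weakly detectable if $\langle A(t)x,x\rangle_X\le\mu\|Cx\|_Y^2$ for all $t\ge0$ and $x\in D$. For the pair $(\mathbb T_\infty,C)$ set $W_\infty(0,\tau)z_0=\int_0^\tau \mathbb T_\infty(t,0)^*C^*C\,\mathbb T_\infty(t,0)z_0\,dt$; the observable subspace of $(\mathbb T_\infty,C)$ is $\mathcal O=\overline{\bigcup_{\tau>0}(\ker W_\infty(0,\tau))^\perp}$. *)

theory Defs
  imports "HOL-Analysis.Analysis"
begin

text \<open>Real Hilbert spaces are types of sort \<open>{real_inner, banach}\<close>. An unbounded operator is given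
  by its domain \<open>D\<close> and a total function whose values outside \<open>D\<close> are irrelevant. Time-dependent
  families are indexed by \<open>real\<close>; only the indices \<open>t \<ge> 0\<close>, respectively \<open>0 \<le> s \<le> t\<close>, matter.\<close>

definition c0_semigroup :: "(real \<Rightarrow> 'a::real_normed_vector \<Rightarrow>\<^sub>L 'a) \<Rightarrow> bool" where
  "c0_semigroup G \<longleftrightarrow>
     G 0 = id_blinfun \<and>
     (\<forall>s\<ge>0. \<forall>t\<ge>0. G (s + t) = G s o\<^sub>L G t) \<and>
     (\<forall>x. ((\<lambda>t. G t x) \<longlongrightarrow> x) (at_right 0))"

text \<open>The equivalence says that the graph of \<open>A\<close> on \<open>D\<close> is exactly the graph of the infinitesimal
  generator of \<open>G\<close>; in particular \<open>D\<close> is the full domain of the generator.\<close>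

definition generates_c0_semigroup :: "'a::real_normed_vector set \<Rightarrow> ('a \<Rightarrow> 'a) \<Rightarrow> bool" where
  "generates_c0_semigroup D A \<longleftrightarrow>
     (\<exists>G. c0_semigroup G \<and>
        (\<forall>x y. (x \<in> D \<and> A x = y) \<longleftrightarrow>
           ((\<lambda>h. (G h x - x) /\<^sub>R h) \<longlongrightarrow> y) (at_right 0)))"

definition resolvent_set :: "'a::real_normed_vector set \<Rightarrow> ('a \<Rightarrow> 'a) \<Rightarrow> real set" where
  "resolvent_set D A =
     {l. bij_betw (\<lambda>x. l *\<^sub>R x - A x) D UNIV \<and>
         bounded_linear (inv_into D (\<lambda>x. l *\<^sub>R x - A x))}"

definition resolvent :: "'a::real_normed_vector set \<Rightarrow> ('a \<Rightarrow> 'a) \<Rightarrow> real \<Rightarrow> 'a \<Rightarrow>\<^sub>L 'a" where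
  "resolvent D A l = Blinfun (inv_into D (\<lambda>x. l *\<^sub>R x - A x))"

text \<open>Stability in the sense of Pazy. For a list \<open>[t\<^sub>1, \<dots>, t\<^sub>k]\<close> the \<open>fold\<close> below is the time-ordered
  product in which factors with larger times stand to the left.\<close>

definition stable_family :: "'a::real_normed_vector set \<Rightarrow> (real \<Rightarrow> 'a \<Rightarrow> 'a) \<Rightarrow> bool" where
  "stable_family D A \<longleftrightarrow>
     (\<exists>M \<omega>. 1 \<le> M \<and>
        (\<forall>t\<ge>0. {\<omega><..} \<subseteq> resolvent_set D (A t)) \<and>
        (\<forall>l>\<omega>. \<forall>ts. sorted ts \<and> (\<forall>t\<in>set ts. 0 \<le> t) \<longrightarrow>
           norm (fold (\<lambda>t P. resolvent D (A t) l o\<^sub>L P) ts id_blinfun)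
             \<le> M / (l - \<omega>) ^ length ts))"

definition strongly_C1_family :: "'a::real_normed_vector set \<Rightarrow> (real \<Rightarrow> 'a \<Rightarrow> 'a) \<Rightarrow> bool" where
  "strongly_C1_family D A \<longleftrightarrow>
     (\<forall>x\<in>D. \<exists>g. continuous_on {0..} g \<and>
        (\<forall>t\<ge>0. ((\<lambda>t. A t x) has_vector_derivative g t) (at t within {0..})))"

definition evolution_system :: "(real \<Rightarrow> real \<Rightarrow> 'a::real_normed_vector \<Rightarrow>\<^sub>L 'a) \<Rightarrow> bool" where
  "evolution_system U \<longleftrightarrow>
     (\<forall>s\<ge>0. U s s = id_blinfun) \<and>
     (\<forall>s \<sigma> t. 0 \<le> s \<and> s \<le> \<sigma> \<and> \<sigma> \<le> t \<longrightarrow> U t \<sigma> o\<^sub>L U \<sigma> s = U t s) \<and>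
     (\<forall>x. continuous_on {(t, s). 0 \<le> s \<and> s \<le> t} (\<lambda>(t, s). U t s x))"

text \<open>\<open>U\<close> is the evolution system generated by \<open>A\<close> on the common domain \<open>D\<close>; the derivatives are
  one-sided on the boundary of \<open>0 \<le> s \<le> t\<close>.\<close>

definition generates_evolution_system ::
    "'a::real_normed_vector set \<Rightarrow> (real \<Rightarrow> 'a \<Rightarrow> 'a) \<Rightarrow> (real \<Rightarrow> real \<Rightarrow> 'a \<Rightarrow>\<^sub>L 'a) \<Rightarrow> bool" where
  "generates_evolution_system D A U \<longleftrightarrow>
     evolution_system U \<and>
     (\<forall>x\<in>D. \<forall>s t. 0 \<le> s \<and> s \<le> t \<longrightarrow>
        U t s x \<in> D \<and>
        ((\<lambda>t. U t s x) has_vector_derivative A t (U t s x)) (at t within {s..}) \<and>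
        ((\<lambda>s. U t s x) has_vector_derivative - U t s (A s x)) (at s within {0..t}))"

definition weakly_detectable ::
    "real \<Rightarrow> 'a::real_inner set \<Rightarrow> (real \<Rightarrow> 'a \<Rightarrow> 'a) \<Rightarrow> ('a \<Rightarrow>\<^sub>L 'b::real_inner) \<Rightarrow> bool" where
  "weakly_detectable \<mu> D A C \<longleftrightarrow> (\<forall>t\<ge>0. \<forall>x\<in>D. A t x \<bullet> x \<le> \<mu> * (norm (C x))\<^sup>2)"

text \<open>The gramian \<open>W(0, \<tau>)\<close>. The integral is the Henstock-Kurzweil one because the Bochner integral
  of the library needs a second countable target, while the Hilbert space here need not be separable.
  For an evolution system the integrand is bounded and weakly continuous, hence Bochner integrable
  in the usual sense, and both integrals agree.\<close>

definition obs_gramian ::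
    "(real \<Rightarrow> real \<Rightarrow> 'a::{real_inner,banach} \<Rightarrow>\<^sub>L 'a) \<Rightarrow> ('a \<Rightarrow>\<^sub>L 'b::{real_inner,banach}) \<Rightarrow>
      real \<Rightarrow> 'a \<Rightarrow> 'a" where
  "obs_gramian U C \<tau> z =
     integral {0..\<tau>} (\<lambda>t. adjoint (U t 0) (adjoint C (C (U t 0 z))))"

definition observable_subspace ::
    "(real \<Rightarrow> real \<Rightarrow> 'a::{real_inner,banach} \<Rightarrow>\<^sub>L 'a) \<Rightarrow> ('a \<Rightarrow>\<^sub>L 'b::{real_inner,banach}) \<Rightarrow>
      'a set" where
  "observable_subspace U C =
     closure (\<Union>\<tau>\<in>{0<..}. orthogonal_comp {z. obs_gramian U C \<tau> z = 0})"

text \<open>Orthogonal projection onto a closed subspace.\<close>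

definition orth_proj :: "'a::real_inner set \<Rightarrow> 'a \<Rightarrow> 'a" where
  "orth_proj S x = (THE p. p \<in> S \<and> x - p \<in> orthogonal_comp S)"

definition weakly_tendsto :: "('i \<Rightarrow> 'a::real_normed_vector) \<Rightarrow> 'a \<Rightarrow> 'i filter \<Rightarrow> bool" where
  "weakly_tendsto f l F \<longleftrightarrow> (\<forall>\<phi> :: 'a \<Rightarrow>\<^sub>L real. ((\<lambda>i. \<phi> (f i)) \<longlongrightarrow> \<phi> l) F)"

end

theory Submission
  imports Defs
begin

text \<open>
  Write \<open>\<epsilon> t\<close> for \<open>S t 0 \<epsilon>0\<close>. The proof is an energy argument followed by a passage to the limit along the
  times \<open>tn\<close>.

  For \<open>\<epsilon>0\<close> in \<open>D\<close>, weak detectability and \<open>\<mu> < r\<close> make \<open>|\<epsilon> t|\<^sup>2\<close> decrease at least as fast as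
  \<open>2 * (r - \<mu>) * |C (\<epsilon> t)|\<^sup>2\<close> (\<open>observer_error_dissipation\<close>). So \<open>S\<close> is a contraction, and the output energy of
  the error on \<open>[t, t + L]\<close> tends to zero as \<open>t\<close> grows (\<open>observer_output_energy_vanishes\<close>). The output is also
  the only thing that separates the error dynamics from the free dynamics: another energy estimate shows that
  \<open>\<epsilon> (t + s) - T (t + s) t (\<epsilon> t)\<close> tends to zero uniformly for \<open>s\<close> in \<open>[0, L]\<close>. Along \<open>tn\<close> the free
  dynamics converges, so the same holds with \<open>Tinf s 0 (\<epsilon> (tn n))\<close>
  (\<open>observer_error_follows_limit_evolution\<close>).

  Hence the limit trajectories issued from \<open>\<epsilon> (tn n)\<close> have vanishing output energy on every bounded interval,
  so \<open>\<epsilon> (tn n) \<bullet> W z\<close> tends to zero for each gramian \<open>W\<close> of \<open>Tinf\<close> and each \<open>z\<close>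
  (\<open>output_small_implies_gramian_null\<close>). As \<open>W\<close> is symmetric, its range is dense in the orthogonal complement of
  its kernel; by boundedness of the errors, \<open>\<epsilon> (tn n) \<bullet> v\<close> tends to zero for all \<open>v\<close> in the observable subspace,
  and by contractivity this extends to all \<open>\<epsilon>0\<close>. That is the first claim.

  For the second claim, let \<open>tn n \<le> t \<le> tn n + L\<close> and \<open>s = t - tn n\<close>. Then \<open>\<epsilon> t \<bullet> v\<close> is close to
  \<open>\<epsilon> (tn n) \<bullet> adjoint (Tinf s 0) v\<close>. Weak convergence is uniform on compact sets of test vectors, but not
  on bounded ones, so the point is that \<open>adjoint (Tinf s 0) v\<close> is continuous in \<open>s\<close> for the norm, although the adjoint of
  a strongly continuous evolution is in general only weakly continuous. It follows from weak detectability: it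
  gives the growth bound \<open>|T t s| \<le> exp (k * (t - s))\<close> with constant \<open>1\<close>, and in a Hilbert space weak convergence
  \<open>adjoint (T t s) v \<rightarrow> v\<close> with such a bound on the norms is strong convergence
  (\<open>quasi_contractive_adjoint_continuous\<close>). The same continuity makes the integrand of the gramian
  continuous, so that its kernel and its quadratic form can be read off from the outputs.
\<close>

section \<open>Orthogonal projection and adjoints in a real Hilbert space\<close>

text \<open>A minimizing sequence for the distance from \<open>x\<close> to \<open>M\<close> is Cauchy by the parallelogram law, since
midpoints of elements of \<open>M\<close> stay in \<open>M\<close>; its limit \<open>p\<close> is a nearest point, and perturbing \<open>p\<close> along a
direction of \<open>M\<close> shows that \<open>x - p\<close> is orthogonal to \<open>M\<close>.\<close>

lemma orthogonal_decomposition: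
  fixes M :: "'a::{real_inner,banach} set"
  assumes "subspace M" and "closed M"
  obtains p where "p \<in> M" and "x - p \<in> orthogonal_comp M"
proof -
  define d where "d = infdist x M"
  have "M \<noteq> {}"
    using assms(1) subspace_0 by blast
  have d_le: "d \<le> norm (x - q)" if "q \<in> M" for q
    using infdist_le[OF that, of x] by (simp add: d_def dist_norm)
  have "d \<ge> 0"
    by (simp add: d_def infdist_nonneg)
  have "\<exists>q\<in>M. norm (x - q) < d + 1 / real (Suc n)" for n
  proof -
    have "(INF q\<in>M. dist x q) < d + 1 / real (Suc n)"
      using \<open>M \<noteq> {}\<close> by (simp add: d_def infdist_notempty)
    then show ?thesis
      using \<open>M \<noteq> {}\<close> by (subst (asm) cINF_less_iff) (auto simp: dist_norm intro: bdd_belowI2[where m = 0])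
  qed
  then obtain q where qM: "\<And>n. q n \<in> M" and q: "\<And>n. norm (x - q n) < d + 1 / real (Suc n)"
    by metis
  have q_lim: "(\<lambda>n. norm (x - q n)) \<longlonglongrightarrow> d"
  proof (rule tendsto_sandwich[where f = "\<lambda>_. d" and h = "\<lambda>n. d + 1 / real (Suc n)"])
    show "(\<lambda>n. d + 1 / real (Suc n)) \<longlonglongrightarrow> d"
      using tendsto_add[OF tendsto_const LIMSEQ_Suc[OF lim_1_over_n], of d] by simp
  qed (use d_le[OF qM] less_imp_le[OF q] in \<open>simp_all add: always_eventually\<close>)
  have parallelogram: "(norm (q m - q n))\<^sup>2
      \<le> 2 * (norm (x - q m))\<^sup>2 + 2 * (norm (x - q n))\<^sup>2 - 4 * d\<^sup>2" for m n
  proof -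
    have "(1/2) *\<^sub>R (q m + q n) \<in> M"
      using assms(1) qM by (simp add: subspace_add subspace_scale)
    then have "d\<^sup>2 \<le> (norm (x - (1/2) *\<^sub>R (q m + q n)))\<^sup>2"
      using d_le \<open>d \<ge> 0\<close> by (intro power_mono) auto
    then show ?thesis
      by (simp add: power2_norm_eq_inner inner_diff_left inner_diff_right inner_add_left
          inner_add_right inner_commute algebra_simps)
  qed
  have "Cauchy q"
  proof (rule metric_CauchyI)
    fix e :: real
    assume "e > 0"
    have "(\<lambda>n. (norm (x - q n))\<^sup>2) \<longlonglongrightarrow> d\<^sup>2"
      by (intro tendsto_intros q_lim)
    then have "\<forall>\<^sub>F n in sequentially. (norm (x - q n))\<^sup>2 < d\<^sup>2 + e\<^sup>2 / 4"
      by (rule order_tendstoD) (use \<open>e > 0\<close> in simp)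
    then obtain N where N: "\<And>n. n \<ge> N \<Longrightarrow> (norm (x - q n))\<^sup>2 < d\<^sup>2 + e\<^sup>2 / 4"
      by (auto simp: eventually_sequentially)
    have "dist (q m) (q n) < e" if "m \<ge> N" "n \<ge> N" for m n
    proof -
      have "(norm (q m - q n))\<^sup>2 < e\<^sup>2"
        using parallelogram[of m n] N[OF that(1)] N[OF that(2)] by simp
      then show ?thesis
        using \<open>e > 0\<close> by (simp add: dist_norm power_less_imp_less_base)
    qed
    then show "\<exists>N. \<forall>m\<ge>N. \<forall>n\<ge>N. dist (q m) (q n) < e"
      by blast
  qed
  then obtain p where p: "q \<longlonglongrightarrow> p"
    using Cauchy_convergent convergent_def by blast
  have "p \<in> M"
    using closed_sequentially[OF assms(2) _ p] qM by simp
  have "norm (x - p) = d"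
    using p by (intro LIMSEQ_unique[OF _ q_lim] tendsto_intros)
  have "(x - p) \<bullet> y = 0" if "y \<in> M" for y
  proof (cases "y = 0")
    case False
    define t where "t = ((x - p) \<bullet> y) / (y \<bullet> y)"
    have "p + t *\<^sub>R y \<in> M"
      using \<open>p \<in> M\<close> that assms(1) by (simp add: subspace_add subspace_scale)
    then have "(norm (x - p))\<^sup>2 \<le> (norm ((x - p) - t *\<^sub>R y))\<^sup>2"
      using d_le[of "p + t *\<^sub>R y"] \<open>norm (x - p) = d\<close> \<open>d \<ge> 0\<close>
      by (intro power_mono) (auto simp: algebra_simps)
    then have "2 * t * ((x - p) \<bullet> y) \<le> t * t * (y \<bullet> y)"
      by (simp add: power2_norm_eq_inner inner_diff_left[of "x - p"] inner_diff_right[of _ "x - p"]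
          inner_commute[of y "x - p"] right_diff_distrib)
    moreover have "t * (y \<bullet> y) = (x - p) \<bullet> y"
      using False by (simp add: t_def)
    ultimately have "t * ((x - p) \<bullet> y) \<le> 0"
      by (metis add_le_same_cancel1 mult.assoc mult_2)
    then have "((x - p) \<bullet> y)\<^sup>2 \<le> 0"
      using inner_gt_zero_iff[of y] False
      by (auto simp: t_def power2_eq_square divide_le_0_iff simp del: inner_gt_zero_iff)
    then show ?thesis
      by simp
  qed simp
  then show thesis
    using that[OF \<open>p \<in> M\<close>] by (auto simp: orthogonal_comp_def orthogonal_def inner_commute)
qed

lemma subspace_closure:
  fixes G :: "'a::real_normed_vector set"
  assumes "subspace G"
  shows "subspace (closure G)"
  unfolding subspace_def
proof (intro conjI ballI allI)
  show "0 \<in> closure G"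
    using subspace_0[OF assms] closure_subset[of G] by auto
next
  fix x y
  assume "x \<in> closure G" "y \<in> closure G"
  then obtain u v where "\<And>n. u n \<in> G" "u \<longlonglongrightarrow> x" "\<And>n. v n \<in> G" "v \<longlonglongrightarrow> y"
    by (meson closure_sequential)
  then show "x + y \<in> closure G"
    using assms unfolding closure_sequential
    by (intro exI[of _ "\<lambda>n. u n + v n"]) (auto intro!: tendsto_add simp: subspace_add)
next
  fix c x
  assume "x \<in> closure G"
  then obtain u where "\<And>n. u n \<in> G" "u \<longlonglongrightarrow> x"
    by (meson closure_sequential)
  then show "c *\<^sub>R x \<in> closure G"
    using assms unfolding closure_sequential
    by (intro exI[of _ "\<lambda>n. c *\<^sub>R u n"]) (auto intro!: tendsto_scaleR simp: subspace_scale)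
qed

lemma orth_proj_unique:
  fixes M :: "'a::{real_inner,banach} set"
  assumes "subspace M" and "p \<in> M" and "x - p \<in> orthogonal_comp M"
  shows "orth_proj M x = p"
  unfolding orth_proj_def
proof (rule the_equality)
  fix p'
  assume *: "p' \<in> M \<and> x - p' \<in> orthogonal_comp M"
  then have "p' - p \<in> M"
    using assms by (simp add: subspace_diff)
  then have "(p' - p) \<bullet> (x - p) = 0" "(p' - p) \<bullet> (x - p') = 0"
    using * assms(3) by (auto simp: orthogonal_comp_def orthogonal_def)
  then have "(p' - p) \<bullet> (p' - p) = 0"
    by (simp add: inner_diff_right)
  then show "p' = p"
    by simp
qed (use assms in auto)

text \<open>The projection is self-adjoint, so testing \<open>orth_proj M w\<close> against \<open>u\<close> is testing \<open>w\<close> against the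
projection of \<open>u\<close>. This turns weak convergence of projections into convergence of inner products with
elements of \<open>M\<close>.\<close>

lemma inner_orth_proj:
  fixes M :: "'a::{real_inner,banach} set"
  assumes "subspace M" and "closed M" and "p \<in> M" and "u - p \<in> orthogonal_comp M"
  shows "orth_proj M w \<bullet> u = w \<bullet> p"
proof -
  obtain q where q: "q \<in> M" "w - q \<in> orthogonal_comp M"
    using orthogonal_decomposition[OF assms(1,2)] by blast
  have "q \<bullet> (u - p) = 0" and "p \<bullet> (w - q) = 0"
    using q assms(3,4) by (auto simp: orthogonal_comp_def orthogonal_def)
  then show ?thesis
    using orth_proj_unique[OF assms(1) q] by (simp add: inner_diff_right inner_commute)
qed

lemma double_orthogonal_comp_subset_closure:
  fixes G :: "'a::{real_inner,banach} set"
  assumes "subspace G"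
  shows "orthogonal_comp (orthogonal_comp G) \<subseteq> closure G"
proof
  fix v
  assume v: "v \<in> orthogonal_comp (orthogonal_comp G)"
  obtain p where p: "p \<in> closure G" "v - p \<in> orthogonal_comp (closure G)"
    using orthogonal_decomposition[of "closure G" v] assms by (auto simp: subspace_closure)
  then have "(v - p) \<bullet> v = 0" "p \<bullet> (v - p) = 0"
    using v orthogonal_comp_anti_mono[OF closure_subset, of G]
    by (auto simp: orthogonal_comp_def orthogonal_def)
  then have "(v - p) \<bullet> (v - p) = 0"
    by (simp add: inner_diff_right inner_diff_left inner_commute)
  then show "v \<in> closure G"
    using p(1) by simp
qed

text \<open>The orthogonal complement of the kernel of a nonzero functional is a line; a vector \<open>w\<close> spanning it,
suitably scaled, represents the functional.\<close>

lemma riesz_representation: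
  fixes f :: "'a::{real_inner,banach} \<Rightarrow> real"
  assumes "bounded_linear f"
  obtains u where "\<And>x. f x = x \<bullet> u"
proof (cases "\<forall>x. f x = 0")
  case True
  then show thesis
    using that[of 0] by simp
next
  case False
  then obtain a where a: "f a \<noteq> 0"
    by blast
  interpret f: bounded_linear f by fact
  let ?K = "{x. f x = 0}"
  have "subspace ?K"
    by (auto simp: subspace_def f.add f.scaleR f.zero)
  moreover have "closed ?K"
    by (intro closed_Collect_eq continuous_intros f.continuous_on)
  ultimately obtain p where p: "p \<in> ?K" "a - p \<in> orthogonal_comp ?K"
    using orthogonal_decomposition by blast
  define w where "w = a - p"
  have fw: "f w \<noteq> 0"
    using a p(1) by (simp add: w_def f.diff)
  have "f x = x \<bullet> ((f w / (w \<bullet> w)) *\<^sub>R w)" for x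
  proof -
    have "x - (f x / f w) *\<^sub>R w \<in> ?K"
      using fw by (simp add: f.diff f.scaleR)
    then have "(x - (f x / f w) *\<^sub>R w) \<bullet> w = 0"
      using p(2) unfolding w_def[symmetric] orthogonal_comp_def orthogonal_def by blast
    then have "x \<bullet> w = f x / f w * (w \<bullet> w)"
      by (simp add: inner_diff_left)
    moreover have "w \<bullet> w \<noteq> 0"
      using fw f.zero by auto
    ultimately show ?thesis
      using fw by simp
  qed
  then show thesis
    by (rule that)
qed

text \<open>The constant \<open>adjoint\<close> is a choice among the functions with this property, so the
lemma amounts to the existence of one, which the Riesz representation of \<open>\<lambda>x. f x \<bullet> y\<close> provides.\<close>

lemma inner_adjoint:
  fixes f :: "'a::{real_inner,banach} \<Rightarrow>\<^sub>L 'b::real_inner"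
  shows "x \<bullet> adjoint f y = f x \<bullet> y"
proof -
  have "\<exists>u. \<forall>x. f x \<bullet> y = x \<bullet> u" for y
  proof -
    have "bounded_linear (\<lambda>x. f x \<bullet> y)"
      by (intro bounded_linear_intros)
    then show ?thesis
      using riesz_representation by metis
  qed
  then have "\<forall>y. \<exists>u. \<forall>x. f x \<bullet> y = x \<bullet> u"
    by blast
  from choice[OF this] have "\<exists>f'. \<forall>x y. f x \<bullet> y = x \<bullet> f' y"
    by blast
  from someI_ex[OF this] have "\<forall>x y. f x \<bullet> y = x \<bullet> adjoint f y"
    unfolding adjoint_def .
  then show ?thesis
    by simp
qed

lemma norm_adjoint_le_bound:
  fixes f :: "'a::{real_inner,banach} \<Rightarrow>\<^sub>L 'b::real_inner"
  assumes "0 \<le> B" and "\<And>x. norm (f x) \<le> B * norm x"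
  shows "norm (adjoint f y) \<le> B * norm y"
proof (cases "adjoint f y = 0")
  case True
  with assms(1) show ?thesis by simp
next
  case False
  have "(norm (adjoint f y))\<^sup>2 = f (adjoint f y) \<bullet> y"
    by (simp add: power2_norm_eq_inner inner_adjoint)
  also have "\<dots> \<le> B * norm (adjoint f y) * norm y"
    using norm_cauchy_schwarz assms(2) mult_right_mono norm_ge_zero order_trans by metis
  finally show ?thesis
    using False by (simp add: power2_eq_square mult.assoc mult.left_commute)
qed

lemma adjoint_diff_right:
  fixes f :: "'a::{real_inner,banach} \<Rightarrow>\<^sub>L 'b::real_inner"
  shows "adjoint f (y - z) = adjoint f y - adjoint f z"
  by (rule vector_eq_ldot[THEN iffD1]) (simp add: inner_adjoint inner_diff_right)

lemma adjoint_diff_left: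
  fixes f g :: "'a::{real_inner,banach} \<Rightarrow>\<^sub>L 'b::real_inner"
  shows "adjoint (f - g) y = adjoint f y - adjoint g y"
  by (rule vector_eq_ldot[THEN iffD1])
    (simp add: inner_adjoint inner_diff_right inner_diff_left blinfun.diff_left)

lemma adjoint_compose:
  fixes f :: "'b::{real_inner,banach} \<Rightarrow>\<^sub>L 'c::real_inner" and g :: "'a::{real_inner,banach} \<Rightarrow>\<^sub>L 'b"
  shows "adjoint (f o\<^sub>L g) y = adjoint g (adjoint f y)"
  by (rule vector_eq_ldot[THEN iffD1]) (simp add: inner_adjoint)

section \<open>Weak convergence to zero\<close>

text \<open>The vectors on which a uniformly bounded family of functionals tends to zero form a closed subspace.
For \<open>S t 0 x \<bullet> v\<close> it is used in both variables: in \<open>v\<close> to pass from the ranges of the gramians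
to the observable subspace, and in \<open>x\<close> to pass from the domain \<open>D\<close> to
all initial errors.\<close>

lemma null_functionals_on_closure_span:
  fixes f :: "'i \<Rightarrow> 'a::real_normed_vector \<Rightarrow> real"
  assumes lin: "\<And>i. linear (f i)" and bound: "\<forall>\<^sub>F i in F. \<forall>x. \<bar>f i x\<bar> \<le> B * norm x"
    and null: "\<And>x. x \<in> G \<Longrightarrow> ((\<lambda>i. f i x) \<longlongrightarrow> 0) F"
    and x: "x \<in> closure (span G)"
  shows "((\<lambda>i. f i x) \<longlongrightarrow> 0) F"
proof -
  have span: "((\<lambda>i. f i y) \<longlongrightarrow> 0) F" if "y \<in> span G" for y
    using that
  proof (induction rule: span_induct_alt)
    case base
    then show ?case
      by (simp add: linear_0[OF lin])
  next
    case (step c y z)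
    have "((\<lambda>i. c * f i y + f i z) \<longlongrightarrow> c * 0 + 0) F"
      using step null by (intro tendsto_intros)
    then show ?case
      by (simp add: linear_add[OF lin] linear_scale[OF lin])
  qed
  show ?thesis
    unfolding tendsto_iff
  proof (intro allI impI)
    fix e :: real
    assume "0 < e"
    define b where "b = \<bar>B\<bar> + 1"
    have "0 < b" and "B \<le> b"
      by (simp_all add: b_def)
    define \<delta> where "\<delta> = e / 2 / b"
    have "0 < \<delta>"
      using \<open>0 < e\<close> \<open>0 < b\<close> by (simp add: \<delta>_def)
    then obtain y where y: "y \<in> span G" "norm (x - y) < \<delta>"
      using x unfolding closure_approachable by (metis dist_commute dist_norm)
    have "\<forall>\<^sub>F i in F. \<bar>f i y\<bar> < e / 2"
      using span[OF y(1)] \<open>0 < e\<close> by (auto simp: tendsto_iff dest: spec[of _ "e / 2"])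
    then show "\<forall>\<^sub>F i in F. dist (f i x) 0 < e"
      using bound
    proof eventually_elim
      case (elim i)
      have "\<bar>f i (x - y)\<bar> \<le> B * norm (x - y)"
        using elim by blast
      also have "\<dots> \<le> b * \<delta>"
        using y(2) \<open>0 < b\<close> \<open>B \<le> b\<close> by (intro mult_mono) auto
      also have "\<dots> = e / 2"
        using \<open>0 < b\<close> by (simp add: \<delta>_def)
      finally have "\<bar>f i x - f i y\<bar> \<le> e / 2"
        by (simp add: linear_diff[OF lin])
      then show ?case
        using elim(1) unfolding dist_norm real_norm_def diff_0_right by linarith
    qed
  qed
qed

text \<open>A finite net of \<open>K\<close> reduces uniform convergence to convergence at finitely many points, because the
functionals \<open>\<lambda>v. x i \<bullet> v\<close> are equi-Lipschitz.\<close>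

lemma weak_null_uniform_on_compact:
  fixes x :: "'i \<Rightarrow> 'a::real_inner"
  assumes "compact K" and bound: "\<And>i. norm (x i) \<le> B"
    and null: "\<And>v. ((\<lambda>i. x i \<bullet> v) \<longlongrightarrow> 0) F"
  shows "uniform_limit K (\<lambda>i v. x i \<bullet> v) (\<lambda>_. 0) F"
proof (rule uniform_limitI)
  fix e :: real
  assume "0 < e"
  define b where "b = \<bar>B\<bar> + 1"
  have "0 < b" and "B \<le> b"
    by (simp_all add: b_def)
  define \<delta> where "\<delta> = e / 2 / b"
  have "0 < \<delta>"
    using \<open>0 < e\<close> \<open>0 < b\<close> by (simp add: \<delta>_def)
  then obtain N where N: "finite N" "K \<subseteq> (\<Union>c\<in>N. ball c \<delta>)"
    using \<open>compact K\<close> unfolding compact_eq_totally_bounded by blast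
  have "\<forall>\<^sub>F i in F. \<forall>c\<in>N. \<bar>x i \<bullet> c\<bar> < e / 2"
  proof (intro eventually_ball_finite N(1) ballI)
    fix c
    show "\<forall>\<^sub>F i in F. \<bar>x i \<bullet> c\<bar> < e / 2"
      using null[of c] \<open>0 < e\<close> by (auto simp: tendsto_iff dest: spec[of _ "e / 2"])
  qed
  then show "\<forall>\<^sub>F i in F. \<forall>v\<in>K. dist (x i \<bullet> v) 0 < e"
  proof (eventually_elim, intro ballI)
    fix i v
    assume small: "\<forall>c\<in>N. \<bar>x i \<bullet> c\<bar> < e / 2" and "v \<in> K"
    then obtain c where c: "c \<in> N" "norm (v - c) < \<delta>"
      using N(2) by (auto simp: dist_norm norm_minus_commute)
    have "\<bar>x i \<bullet> (v - c)\<bar> \<le> norm (x i) * norm (v - c)"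
      by (rule Cauchy_Schwarz_ineq2)
    also have "\<dots> \<le> b * \<delta>"
      using c(2) bound[of i] \<open>0 < b\<close> \<open>B \<le> b\<close> by (intro mult_mono) auto
    also have "\<dots> = e / 2"
      using \<open>0 < b\<close> by (simp add: \<delta>_def)
    finally have "\<bar>x i \<bullet> v - x i \<bullet> c\<bar> \<le> e / 2"
      by (simp add: inner_diff_right)
    moreover have "\<bar>x i \<bullet> c\<bar> < e / 2"
      using small c(1) by blast
    ultimately show "dist (x i \<bullet> v) 0 < e"
      unfolding dist_norm real_norm_def diff_0_right by linarith
  qed
qed

lemma weakly_tendsto_0_iff:
  fixes f :: "'i \<Rightarrow> 'a::{real_inner,banach}"
  shows "weakly_tendsto f 0 F \<longleftrightarrow> (\<forall>u. ((\<lambda>i. f i \<bullet> u) \<longlongrightarrow> 0) F)"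
proof
  assume w: "weakly_tendsto f 0 F"
  show "\<forall>u. ((\<lambda>i. f i \<bullet> u) \<longlongrightarrow> 0) F"
  proof
    fix u
    have "((\<lambda>i. blinfun_inner_left u (f i)) \<longlongrightarrow> blinfun_inner_left u 0) F"
      using w unfolding weakly_tendsto_def by blast
    then show "((\<lambda>i. f i \<bullet> u) \<longlongrightarrow> 0) F"
      by (simp add: inner_commute)
  qed
next
  assume u: "\<forall>u. ((\<lambda>i. f i \<bullet> u) \<longlongrightarrow> 0) F"
  show "weakly_tendsto f 0 F"
    unfolding weakly_tendsto_def
  proof
    fix \<phi> :: "'a \<Rightarrow>\<^sub>L real"
    obtain u where "\<And>x. \<phi> x = x \<bullet> u"
      using riesz_representation[OF blinfun.bounded_linear_right] by metis
    then show "((\<lambda>i. \<phi> (f i)) \<longlongrightarrow> \<phi> 0) F"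
      using u by simp
  qed
qed

section \<open>Energy estimates\<close>

lemma increment_le_integral:
  fixes \<phi> g :: "real \<Rightarrow> real"
  assumes "a \<le> b"
    and "\<And>t. t \<in> {a..b} \<Longrightarrow> (\<phi> has_real_derivative \<phi>' t) (at t within {a..b})"
    and "\<And>t. t \<in> {a..b} \<Longrightarrow> \<phi>' t \<le> g t"
    and "g integrable_on {a..b}"
  shows "\<phi> b - \<phi> a \<le> integral {a..b} g"
proof (rule has_integral_le[OF _ integrable_integral])
  show "(\<phi>' has_integral (\<phi> b - \<phi> a)) {a..b}"
    using assms(1,2)
    by (intro fundamental_theorem_of_calculus)
      (auto simp: has_real_derivative_iff_has_vector_derivative)
qed (use assms in auto)

text \<open>The factor \<open>exp (- K * (t - a))\<close> absorbs the linear term; it is at most \<open>1\<close> on the interval, so it can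
be dropped in front of the nonnegative \<open>g\<close>.\<close>

lemma gronwall:
  fixes \<phi> g :: "real \<Rightarrow> real"
  assumes "a \<le> b" and "0 \<le> K"
    and "\<And>t. t \<in> {a..b} \<Longrightarrow> (\<phi> has_real_derivative \<phi>' t) (at t within {a..b})"
    and "\<And>t. t \<in> {a..b} \<Longrightarrow> \<phi>' t \<le> K * \<phi> t + g t"
    and "\<And>t. t \<in> {a..b} \<Longrightarrow> 0 \<le> g t"
    and "g integrable_on {a..b}"
  shows "\<phi> b \<le> exp (K * (b - a)) * (\<phi> a + integral {a..b} g)"
proof -
  let ?\<psi> = "\<lambda>t. exp (- K * (t - a)) * \<phi> t"
  have "?\<psi> b - ?\<psi> a \<le> integral {a..b} g"
  proof (rule increment_le_integral[where \<phi>' = "\<lambda>t. exp (- K * (t - a)) * (\<phi>' t - K * \<phi> t)"])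
    fix t
    assume t: "t \<in> {a..b}"
    show "(?\<psi> has_real_derivative exp (- K * (t - a)) * (\<phi>' t - K * \<phi> t)) (at t within {a..b})"
      by (rule derivative_eq_intros assms(3)[OF t] refl)+ (simp add: algebra_simps)
    have "exp (- K * (t - a)) * (\<phi>' t - K * \<phi> t) \<le> exp (- K * (t - a)) * g t"
      using assms(4)[OF t] by (intro mult_left_mono) auto
    also have "\<dots> \<le> g t"
      using t assms(2,5) by (intro mult_left_le_one_le) auto
    finally show "exp (- K * (t - a)) * (\<phi>' t - K * \<phi> t) \<le> g t" .
  qed (use assms in auto)
  then have "exp (K * (b - a)) * ?\<psi> b \<le> exp (K * (b - a)) * (\<phi> a + integral {a..b} g)"
    by simp
  then show ?thesis
    by (simp add: mult.assoc[symmetric] exp_add[symmetric])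
qed

lemma has_real_derivative_norm_squared:
  fixes v :: "real \<Rightarrow> 'a::real_inner"
  assumes "(v has_vector_derivative v') (at t within S)"
  shows "((\<lambda>t. (norm (v t))\<^sup>2) has_real_derivative 2 * (v' \<bullet> v t)) (at t within S)"
proof -
  have "((\<lambda>t. v t \<bullet> v t) has_derivative (\<lambda>h. v t \<bullet> (h *\<^sub>R v') + (h *\<^sub>R v') \<bullet> v t)) (at t within S)"
    using assms by (intro has_derivative_inner) (auto simp: has_vector_derivative_def)
  then show ?thesis
    unfolding has_field_derivative_def power2_norm_eq_inner
    by (rule has_derivative_eq_rhs) (auto simp: inner_commute algebra_simps)
qed

text \<open>A generator is a derivative at zero, hence linear on its domain. This lets the
deviation between two trajectories satisfy the equation of the system.\<close>

lemma generator_diff: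
  assumes "generates_c0_semigroup D A" and "x \<in> D" and "y \<in> D"
  shows "x - y \<in> D \<and> A (x - y) = A x - A y"
proof -
  obtain G :: "real \<Rightarrow> 'a \<Rightarrow>\<^sub>L 'a" where
    G: "\<And>x y. (x \<in> D \<and> A x = y) \<longleftrightarrow> ((\<lambda>h. (G h x - x) /\<^sub>R h) \<longlongrightarrow> y) (at_right 0)"
    using assms(1) unfolding generates_c0_semigroup_def by blast
  have "((\<lambda>h. (G h x - x) /\<^sub>R h - (G h y - y) /\<^sub>R h) \<longlongrightarrow> A x - A y) (at_right 0)"
    using G assms(2,3) by (intro tendsto_diff) blast+
  moreover have "(\<lambda>h. (G h x - x) /\<^sub>R h - (G h y - y) /\<^sub>R h) = (\<lambda>h. (G h (x - y) - (x - y)) /\<^sub>R h)"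
    by (auto simp: blinfun.diff_right algebra_simps)
  ultimately show ?thesis
    using G by metis
qed

lemma blinfun_norm_le_of_dense:
  assumes "closure D = UNIV" and "\<And>x. x \<in> D \<Longrightarrow> norm (blinfun_apply F x) \<le> c * norm x"
  shows "norm (F x) \<le> c * norm x"
proof -
  have "closed {x. norm (F x) \<le> c * norm x}"
    by (intro closed_Collect_le continuous_intros)
  then have "closure D \<subseteq> {x. norm (F x) \<le> c * norm x}"
    using assms(2) by (intro closure_minimal) auto
  then show ?thesis
    using assms(1) by blast
qed

lemma evolution_continuous_first:
  assumes "evolution_system U" and "0 \<le> s"
  shows "continuous_on {s..} (\<lambda>t. U t s x)"
proof -
  have "continuous_on {(t, s). 0 \<le> s \<and> s \<le> t} (\<lambda>(t, s). U t s x)"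
    using assms(1) by (auto simp: evolution_system_def)
  then have "continuous_on {s..} (\<lambda>t. (case (t, s) of (t, s) \<Rightarrow> U t s x))"
    by (rule continuous_on_compose2) (use assms(2) in \<open>auto intro!: continuous_intros\<close>)
  then show ?thesis
    by simp
qed

lemma evolution_output_continuous:
  assumes "evolution_system U" and "0 \<le> s" and "s \<le> a"
  shows "continuous_on {a..b} (\<lambda>t. blinfun_apply C (U t s x))"
  using continuous_on_subset[OF evolution_continuous_first[OF assms(1,2)]] assms(3)
  by (intro bounded_linear.continuous_on[OF blinfun.bounded_linear_right]) auto

text \<open>Weak detectability bounds the only term of \<open>d/dt |v|\<^sup>2\<close> that involves the unbounded operator by
\<open>2 * \<mu> * |C v|\<^sup>2\<close>; the coupling \<open>- 2 * r * (h \<bullet> C v)\<close> is split by Young's inequality. What remains is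
bounded by a multiple of \<open>|v|\<^sup>2\<close> plus \<open>r * |h|\<^sup>2\<close>. The forcing enters as \<open>C\<^sup>* h\<close>, with
\<open>h = 0\<close> for the free system and \<open>h\<close> the output of the observer error for its deviation from the free system.\<close>

lemma weakly_detectable_perturbation_estimate:
  fixes C :: "'a::{real_inner,banach} \<Rightarrow>\<^sub>L 'b::{real_inner,banach}"
  assumes wd: "weakly_detectable \<mu> D A C" and "0 \<le> \<mu>" and "0 \<le> r" and "0 \<le> a" and "a \<le> b"
    and v: "\<And>t. t \<in> {a..b} \<Longrightarrow> v t \<in> D \<and>
      (v has_vector_derivative A t (v t) - r *\<^sub>R adjoint C (h t)) (at t within {a..b})"
    and h: "continuous_on {a..b} h"
  shows "(norm (v b))\<^sup>2 \<le> exp ((2 * \<mu> + r) * (norm C)\<^sup>2 * (b - a)) *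
    ((norm (v a))\<^sup>2 + r * integral {a..b} (\<lambda>t. (norm (h t))\<^sup>2))"
proof -
  have "(norm (v b))\<^sup>2 \<le> exp ((2 * \<mu> + r) * (norm C)\<^sup>2 * (b - a)) *
    ((norm (v a))\<^sup>2 + integral {a..b} (\<lambda>t. r * (norm (h t))\<^sup>2))"
  proof (rule gronwall[where
        \<phi>' = "\<lambda>t. 2 * ((A t (v t) - r *\<^sub>R adjoint C (h t)) \<bullet> v t)"])
    fix t
    assume t: "t \<in> {a..b}"
    show "((\<lambda>t. (norm (v t))\<^sup>2) has_real_derivative
        2 * ((A t (v t) - r *\<^sub>R adjoint C (h t)) \<bullet> v t)) (at t within {a..b})"
      using v[OF t] by (intro has_real_derivative_norm_squared) simp
    have "A t (v t) \<bullet> v t \<le> \<mu> * (norm (C (v t)))\<^sup>2"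
      using wd v[OF t] t \<open>0 \<le> a\<close> by (simp add: weakly_detectable_def)
    moreover have "- 2 * (r * (h t \<bullet> C (v t))) \<le> r * ((norm (h t))\<^sup>2 + (norm (C (v t)))\<^sup>2)"
    proof -
      have "0 \<le> r * (norm (h t + C (v t)))\<^sup>2"
        using \<open>0 \<le> r\<close> by simp
      then show ?thesis
        by (simp add: power2_norm_eq_inner inner_add_left inner_add_right inner_commute
            algebra_simps)
    qed
    ultimately have "2 * ((A t (v t) - r *\<^sub>R adjoint C (h t)) \<bullet> v t)
        \<le> (2 * \<mu> + r) * (norm (C (v t)))\<^sup>2 + r * (norm (h t))\<^sup>2"
      by (simp add: inner_diff_left inner_commute[of _ "v t"] inner_adjoint
          inner_commute[of "C (v t)"] algebra_simps)
    also have "(norm (C (v t)))\<^sup>2 \<le> (norm C * norm (v t))\<^sup>2"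
      by (intro power_mono norm_blinfun) simp
    finally show "2 * ((A t (v t) - r *\<^sub>R adjoint C (h t)) \<bullet> v t)
        \<le> (2 * \<mu> + r) * (norm C)\<^sup>2 * (norm (v t))\<^sup>2 + r * (norm (h t))\<^sup>2"
      using \<open>0 \<le> \<mu>\<close> \<open>0 \<le> r\<close> by (simp add: mult_left_mono power_mult_distrib mult.assoc)
  next
    show "(\<lambda>t. r * (norm (h t))\<^sup>2) integrable_on {a..b}"
      by (intro integrable_continuous_real continuous_intros h)
  qed (use assms in auto)
  then show ?thesis
    by simp
qed

text \<open>The estimate with constant factor \<open>1\<close> in front of the exponential is essential: it makes the adjoint
evolution strongly continuous below.\<close>

lemma detectable_evolution_growth:
  fixes C :: "'a::{real_inner,banach} \<Rightarrow>\<^sub>L 'b::{real_inner,banach}"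
  assumes wd: "weakly_detectable \<mu> D A C" and "0 \<le> \<mu>" and "closure D = UNIV"
    and T: "generates_evolution_system D A T"
    and "0 \<le> s" and "s \<le> t"
  shows "norm (T t s x) \<le> exp (\<mu> * (norm C)\<^sup>2 * (t - s)) * norm x"
proof (rule blinfun_norm_le_of_dense[OF \<open>closure D = UNIV\<close>])
  fix x
  assume "x \<in> D"
  have "(norm (T t s x))\<^sup>2 \<le> exp ((2 * \<mu> + 0) * (norm C)\<^sup>2 * (t - s)) *
      ((norm (T s s x))\<^sup>2 + 0 * integral {s..t} (\<lambda>t. (norm (0::'b))\<^sup>2))"
  proof (rule weakly_detectable_perturbation_estimate[OF wd, where h = "\<lambda>_. 0"])
    fix \<sigma>
    assume "\<sigma> \<in> {s..t}"
    then have "T \<sigma> s x \<in> D"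
      and "((\<lambda>t. T t s x) has_vector_derivative A \<sigma> (T \<sigma> s x)) (at \<sigma> within {s..})"
      using T \<open>x \<in> D\<close> \<open>0 \<le> s\<close> by (auto simp: generates_evolution_system_def)
    then show "T \<sigma> s x \<in> D \<and> ((\<lambda>t. T t s x) has_vector_derivative
        A \<sigma> (T \<sigma> s x) - 0 *\<^sub>R adjoint C 0) (at \<sigma> within {s..t})"
      by (auto intro: has_vector_derivative_within_subset)
  qed (use assms in auto)
  also have "T s s x = x"
    using T \<open>0 \<le> s\<close> by (simp add: generates_evolution_system_def evolution_system_def)
  finally have "(norm (T t s x))\<^sup>2 \<le> (exp (\<mu> * (norm C)\<^sup>2 * (t - s)) * norm x)\<^sup>2"
    by (simp add: power_mult_distrib exp_double[symmetric] mult.assoc)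
  then show "norm (T t s x) \<le> exp (\<mu> * (norm C)\<^sup>2 * (t - s)) * norm x"
    by (rule power2_le_imp_le) simp
qed

text \<open>The correction term contributes \<open>- 2 * r * |C \<epsilon>|\<^sup>2\<close> to \<open>d/dt |\<epsilon>|\<^sup>2\<close>, and weak detectability lets the
free dynamics contribute at most \<open>2 * \<mu> * |C \<epsilon>|\<^sup>2\<close>.\<close>

lemma observer_error_dissipation:
  fixes C :: "'a::{real_inner,banach} \<Rightarrow>\<^sub>L 'b::{real_inner,banach}"
  assumes wd: "weakly_detectable \<mu> D A C"
    and S: "generates_evolution_system D (\<lambda>t x. A t x - r *\<^sub>R adjoint C (C x)) S"
    and "x \<in> D" and "0 \<le> a" and "a \<le> b"
  shows "2 * (r - \<mu>) * integral {a..b} (\<lambda>t. (norm (C (S t 0 x)))\<^sup>2)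
    \<le> (norm (S a 0 x))\<^sup>2 - (norm (S b 0 x))\<^sup>2"
proof -
  let ?v = "\<lambda>t. S t 0 x"
  let ?v' = "\<lambda>t. A t (?v t) - r *\<^sub>R adjoint C (C (?v t))"
  have cont: "continuous_on {a..b} (\<lambda>t. C (?v t))"
    using S \<open>0 \<le> a\<close>
    by (intro evolution_output_continuous) (auto simp: generates_evolution_system_def)
  have "(norm (?v b))\<^sup>2 - (norm (?v a))\<^sup>2
      \<le> integral {a..b} (\<lambda>t. - (2 * (r - \<mu>)) * (norm (C (?v t)))\<^sup>2)"
  proof (rule increment_le_integral[where \<phi>' = "\<lambda>t. 2 * (?v' t \<bullet> ?v t)"])
    fix t
    assume t: "t \<in> {a..b}"
    then have "?v t \<in> D" and "(?v has_vector_derivative ?v' t) (at t within {0..})"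
      using S \<open>x \<in> D\<close> \<open>0 \<le> a\<close> by (auto simp: generates_evolution_system_def)
    moreover from this have "(?v has_vector_derivative ?v' t) (at t within {a..b})"
      using \<open>0 \<le> a\<close> by (auto intro: has_vector_derivative_within_subset)
    ultimately show "((\<lambda>t. (norm (?v t))\<^sup>2) has_real_derivative 2 * (?v' t \<bullet> ?v t))
        (at t within {a..b})"
      by (intro has_real_derivative_norm_squared) simp
    have "A t (?v t) \<bullet> ?v t \<le> \<mu> * (norm (C (?v t)))\<^sup>2"
      using wd \<open>?v t \<in> D\<close> t \<open>0 \<le> a\<close> by (simp add: weakly_detectable_def)
    then show "2 * (?v' t \<bullet> ?v t) \<le> - (2 * (r - \<mu>)) * (norm (C (?v t)))\<^sup>2"
      by (simp add: inner_diff_left inner_commute[of _ "?v t"] inner_adjoint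
          power2_norm_eq_inner algebra_simps)
  next
    show "(\<lambda>t. - (2 * (r - \<mu>)) * (norm (C (?v t)))\<^sup>2) integrable_on {a..b}"
      by (intro integrable_continuous_real continuous_intros cont)
  qed (use assms in auto)
  also have "\<dots> = - (2 * (r - \<mu>) * integral {a..b} (\<lambda>t. (norm (C (?v t)))\<^sup>2))"
    by (subst integral_mult_right) (rule mult_minus_left)
  finally show ?thesis
    by linarith
qed

lemma observer_error_contraction:
  fixes C :: "'a::{real_inner,banach} \<Rightarrow>\<^sub>L 'b::{real_inner,banach}"
  assumes "weakly_detectable \<mu> D A C" and "\<mu> < r" and "closure D = UNIV"
    and S: "generates_evolution_system D (\<lambda>t x. A t x - r *\<^sub>R adjoint C (C x)) S"
    and "0 \<le> t"
  shows "norm (S t 0 x) \<le> norm x"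
proof -
  have "norm (S t 0 x) \<le> 1 * norm x"
  proof (rule blinfun_norm_le_of_dense[OF \<open>closure D = UNIV\<close>])
    fix x
    assume "x \<in> D"
    have "continuous_on {0..t} (\<lambda>t. C (S t 0 x))"
      using S by (intro evolution_output_continuous) (auto simp: generates_evolution_system_def)
    then have "0 \<le> integral {0..t} (\<lambda>t. (norm (C (S t 0 x)))\<^sup>2)"
      by (intro integral_nonneg integrable_continuous_real continuous_on_power continuous_on_norm)
        auto
    then have "0 \<le> 2 * (r - \<mu>) * integral {0..t} (\<lambda>t. (norm (C (S t 0 x)))\<^sup>2)"
      using \<open>\<mu> < r\<close> by simp
    also have "\<dots> \<le> (norm (S 0 0 x))\<^sup>2 - (norm (S t 0 x))\<^sup>2"
      using observer_error_dissipation[OF assms(1) S \<open>x \<in> D\<close>, of 0 t] \<open>0 \<le> t\<close> by simp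
    also have "S 0 0 x = x"
      using S by (simp add: generates_evolution_system_def evolution_system_def)
    finally show "norm (S t 0 x) \<le> 1 * norm x"
      by (simp add: power2_le_iff_abs_le)
  qed
  then show ?thesis
    by simp
qed

text \<open>The squared norm of the error decreases and is bounded below, so its decrease over windows of fixed
length tends to zero; by dissipation it dominates the output energy of the window.\<close>

lemma observer_output_energy_vanishes:
  fixes C :: "'a::{real_inner,banach} \<Rightarrow>\<^sub>L 'b::{real_inner,banach}"
  assumes wd: "weakly_detectable \<mu> D A C" and "\<mu> < r"
    and S: "generates_evolution_system D (\<lambda>t x. A t x - r *\<^sub>R adjoint C (C x)) S"
    and "x \<in> D" and "0 \<le> L"
  shows "((\<lambda>t. integral {t..t + L} (\<lambda>\<sigma>. (norm (C (S \<sigma> 0 x)))\<^sup>2)) \<longlongrightarrow> 0) at_top"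
proof -
  let ?I = "\<lambda>a b. integral {a..b} (\<lambda>\<sigma>. (norm (C (S \<sigma> 0 x)))\<^sup>2)"
  define \<phi> where "\<phi> t = (norm (S t 0 x))\<^sup>2" for t
  have I_nonneg: "0 \<le> ?I a b" if "0 \<le> a" for a b
  proof -
    have "continuous_on {a..b} (\<lambda>t. C (S t 0 x))"
      using S that
      by (intro evolution_output_continuous) (auto simp: generates_evolution_system_def)
    then show ?thesis
      by (intro integral_nonneg integrable_continuous_real continuous_on_power continuous_on_norm)
        auto
  qed
  have dissipation: "2 * (r - \<mu>) * ?I a b \<le> \<phi> a - \<phi> b" if "0 \<le> a" "a \<le> b" for a b
    using observer_error_dissipation[OF wd S \<open>x \<in> D\<close> that] by (simp add: \<phi>_def)
  have antimono: "\<phi> b \<le> \<phi> a" if "0 \<le> a" "a \<le> b" for a b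
  proof -
    have "0 \<le> 2 * (r - \<mu>) * ?I a b"
      using I_nonneg[OF that(1)] \<open>\<mu> < r\<close> by simp
    then show ?thesis
      using dissipation[OF that] by linarith
  qed
  define l where "l = Inf (\<phi> ` {0..})"
  have bdd: "bdd_below (\<phi> ` {0..})"
    by (intro bdd_belowI2[where m = 0]) (simp add: \<phi>_def)
  have l_le: "l \<le> \<phi> t" if "0 \<le> t" for t
    unfolding l_def by (intro cInf_lower bdd) (use that in auto)
  show ?thesis
    unfolding tendsto_iff
  proof (intro allI impI)
    fix e :: real
    assume "0 < e"
    then have "Inf (\<phi> ` {0..}) < l + 2 * (r - \<mu>) * e"
      using \<open>\<mu> < r\<close> by (simp add: l_def)
    then obtain t0 where t0: "0 \<le> t0" "\<phi> t0 < l + 2 * (r - \<mu>) * e"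
      using bdd by (subst (asm) cInf_less_iff) auto
    have "dist (?I t (t + L)) 0 < e" if "t0 \<le> t" for t
    proof -
      have "2 * (r - \<mu>) * ?I t (t + L) \<le> \<phi> t - \<phi> (t + L)"
        using that t0(1) \<open>0 \<le> L\<close> by (intro dissipation) auto
      also have "\<dots> < 2 * (r - \<mu>) * e"
        using antimono[of t0 t] l_le[of "t + L"] t0 that \<open>0 \<le> L\<close> by auto
      finally show ?thesis
        using \<open>\<mu> < r\<close> I_nonneg[of t] t0(1) that by simp
    qed
    then show "\<forall>\<^sub>F t in at_top. dist (?I t (t + L)) 0 < e"
      using eventually_at_top_linorder by blast
  qed
qed

text \<open>The deviation vanishes at time \<open>a\<close> and solves the free equation with forcing \<open>- r * C\<^sup>* h\<close>, where \<open>h\<close> is the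
output of the observer error, so the energy estimate applies to the deviation itself.\<close>

lemma observer_error_follows_free_evolution:
  fixes C :: "'a::{real_inner,banach} \<Rightarrow>\<^sub>L 'b::{real_inner,banach}"
  assumes wd: "weakly_detectable \<mu> D A C" and "0 \<le> \<mu>" and "0 \<le> r"
    and gen: "\<And>t. 0 \<le> t \<Longrightarrow> generates_c0_semigroup D (A t)"
    and T: "generates_evolution_system D A T"
    and S: "generates_evolution_system D (\<lambda>t x. A t x - r *\<^sub>R adjoint C (C x)) S"
    and "x \<in> D" and "0 \<le> a" and "a \<le> b"
  shows "(norm (S b 0 x - T b a (S a 0 x)))\<^sup>2 \<le> exp ((2 * \<mu> + r) * (norm C)\<^sup>2 * (b - a)) *
    (r * integral {a..b} (\<lambda>t. (norm (C (S t 0 x)))\<^sup>2))"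
proof -
  let ?v = "\<lambda>t. S t 0 x - T t a (S a 0 x)"
  have Sa: "S a 0 x \<in> D"
    using S \<open>x \<in> D\<close> \<open>0 \<le> a\<close> by (simp add: generates_evolution_system_def)
  have "(norm (?v b))\<^sup>2 \<le> exp ((2 * \<mu> + r) * (norm C)\<^sup>2 * (b - a)) *
      ((norm (?v a))\<^sup>2 + r * integral {a..b} (\<lambda>t. (norm (C (S t 0 x)))\<^sup>2))"
  proof (rule weakly_detectable_perturbation_estimate[OF wd \<open>0 \<le> \<mu>\<close> \<open>0 \<le> r\<close> \<open>0 \<le> a\<close> \<open>a \<le> b\<close>])
    fix t
    assume t: "t \<in> {a..b}"
    then have D: "S t 0 x \<in> D" "T t a (S a 0 x) \<in> D"
      and der: "((\<lambda>t. S t 0 x) has_vector_derivative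
          A t (S t 0 x) - r *\<^sub>R adjoint C (C (S t 0 x))) (at t within {0..})"
        "((\<lambda>t. T t a (S a 0 x)) has_vector_derivative A t (T t a (S a 0 x))) (at t within {a..})"
      using S T \<open>x \<in> D\<close> Sa \<open>0 \<le> a\<close> by (auto simp: generates_evolution_system_def)
    have diff: "?v t \<in> D \<and> A t (?v t) = A t (S t 0 x) - A t (T t a (S a 0 x))"
      using t \<open>0 \<le> a\<close> by (intro generator_diff[OF gen D]) auto
    have "(?v has_vector_derivative
        (A t (S t 0 x) - r *\<^sub>R adjoint C (C (S t 0 x))) - A t (T t a (S a 0 x)))
        (at t within {a..b})"
      using \<open>0 \<le> a\<close>
      by (intro has_vector_derivative_diff der[THEN has_vector_derivative_within_subset]) auto
    moreover have "A t (S t 0 x) - r *\<^sub>R adjoint C (C (S t 0 x)) - A t (T t a (S a 0 x))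
        = A t (?v t) - r *\<^sub>R adjoint C (C (S t 0 x))"
      using diff by simp
    ultimately show "?v t \<in> D \<and> (?v has_vector_derivative
        A t (?v t) - r *\<^sub>R adjoint C (C (S t 0 x))) (at t within {a..b})"
      using diff by metis
  next
    show "continuous_on {a..b} (\<lambda>t. C (S t 0 x))"
      using S \<open>0 \<le> a\<close>
      by (intro evolution_output_continuous) (auto simp: generates_evolution_system_def)
  qed
  also have "?v a = 0"
    using T \<open>0 \<le> a\<close> by (simp add: generates_evolution_system_def evolution_system_def)
  finally show ?thesis
    by simp
qed

text \<open>On a window of fixed length the deviation from the free evolution is controlled by the output energy of that
window, which vanishes at infinity.\<close>

lemma observer_error_asymptotically_free:
  fixes C :: "'a::{real_inner,banach} \<Rightarrow>\<^sub>L 'b::{real_inner,banach}"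
  assumes wd: "weakly_detectable \<mu> D A C" and "0 \<le> \<mu>" and "\<mu> < r"
    and gen: "\<And>t. 0 \<le> t \<Longrightarrow> generates_c0_semigroup D (A t)"
    and T: "generates_evolution_system D A T"
    and S: "generates_evolution_system D (\<lambda>t x. A t x - r *\<^sub>R adjoint C (C x)) S"
    and "x \<in> D" and "0 \<le> L"
  shows "uniform_limit {0..L} (\<lambda>t s. S (t + s) 0 x - T (t + s) t (S t 0 x)) (\<lambda>_. 0) at_top"
proof (rule uniform_limitI)
  fix e :: real
  assume "0 < e"
  let ?I = "\<lambda>a b. integral {a..b} (\<lambda>\<sigma>. (norm (C (S \<sigma> 0 x)))\<^sup>2)"
  define K where "K = exp ((2 * \<mu> + r) * (norm C)\<^sup>2 * L) * r"
  have "0 \<le> r"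
    using assms by simp
  have "((\<lambda>t. K * ?I t (t + L)) \<longlongrightarrow> K * 0) at_top"
    using assms by (intro tendsto_intros observer_output_energy_vanishes)
  then have "\<forall>\<^sub>F t in at_top. K * ?I t (t + L) < e\<^sup>2"
    by (rule order_tendstoD) (use \<open>0 < e\<close> in simp)
  then show "\<forall>\<^sub>F t in at_top. \<forall>s\<in>{0..L}. dist (S (t + s) 0 x - T (t + s) t (S t 0 x)) 0 < e"
    using eventually_ge_at_top[of 0]
  proof eventually_elim
    case (elim t)
    have "norm (S (t + s) 0 x - T (t + s) t (S t 0 x)) < e" if s: "s \<in> {0..L}" for s
    proof -
      have cont: "continuous_on {t..t + c} (\<lambda>t. (norm (C (S t 0 x)))\<^sup>2)" for c
        using S \<open>0 \<le> t\<close>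
        by (intro continuous_on_power continuous_on_norm evolution_output_continuous)
          (auto simp: generates_evolution_system_def)
      have le: "?I t (t + s) \<le> ?I t (t + L)"
        using s by (intro integral_subset_le integrable_continuous_real cont) auto
      have I0: "0 \<le> ?I t (t + s)"
        by (intro integral_nonneg integrable_continuous_real cont) auto
      have "(norm (S (t + s) 0 x - T (t + s) t (S t 0 x)))\<^sup>2
          \<le> exp ((2 * \<mu> + r) * (norm C)\<^sup>2 * (t + s - t)) * (r * ?I t (t + s))"
        using s \<open>0 \<le> t\<close> \<open>x \<in> D\<close>
        by (intro observer_error_follows_free_evolution[OF wd \<open>0 \<le> \<mu>\<close> \<open>0 \<le> r\<close> gen T S]) auto
      also have "\<dots> \<le> exp ((2 * \<mu> + r) * (norm C)\<^sup>2 * L) * (r * ?I t (t + L))"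
        using s \<open>0 \<le> \<mu>\<close> \<open>0 \<le> r\<close> le I0
        by (intro mult_mono mult_left_mono) (auto intro!: mult_left_mono mult_nonneg_nonneg)
      also have "\<dots> < e\<^sup>2"
        using elim(1) by (simp add: K_def mult.assoc)
      finally show ?thesis
        using \<open>0 < e\<close> by (simp add: power_less_imp_less_base)
    qed
    then show ?case
      by simp
  qed
qed

section \<open>Strong continuity of the adjoint evolution\<close>

text \<open>In a Hilbert space, weak convergence together with an upper bound on the norms gives strong convergence:
when \<open>c\<close> is close to \<open>1\<close> and \<open>F v\<close> is close to \<open>v\<close>, the right-hand side is close to zero.\<close>

lemma quasi_contraction_adjoint_displacement:
  fixes F :: "'a::{real_inner,banach} \<Rightarrow>\<^sub>L 'a"
  assumes "0 \<le> c" and "\<And>x. norm (F x) \<le> c * norm x"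
  shows "(norm (adjoint F v - v))\<^sup>2 \<le> (c\<^sup>2 + 1) * (norm v)\<^sup>2 - 2 * (F v \<bullet> v)"
proof -
  have "(norm (adjoint F v - v))\<^sup>2
      = (norm (adjoint F v))\<^sup>2 + (norm v)\<^sup>2 - 2 * (v \<bullet> adjoint F v)"
    by (simp add: power2_norm_eq_inner inner_diff_left inner_diff_right
        inner_commute[of "adjoint F v" v])
  moreover have "(norm (adjoint F v))\<^sup>2 \<le> (c * norm v)\<^sup>2"
    by (intro power_mono norm_adjoint_le_bound assms) simp
  ultimately show ?thesis
    by (simp add: power_mult_distrib distrib_right inner_adjoint)
qed

text \<open>For a general evolution system \<open>adjoint (U t s) v\<close> depends only weakly continuously on \<open>t\<close>. If the growth
bound tends to \<open>1\<close> for short times, then \<open>adjoint (U b a) v\<close> tends to \<open>v\<close> in norm as \<open>b - a\<close> tends to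
zero, and the factorization \<open>U b s = U b a o U a s\<close> moves this to arbitrary times, from the left and from
the right at once.\<close>

lemma quasi_contractive_adjoint_continuous:
  fixes U :: "real \<Rightarrow> real \<Rightarrow> 'a::{real_inner,banach} \<Rightarrow>\<^sub>L 'a"
  assumes U: "evolution_system U" and "0 \<le> s" and "0 \<le> k"
    and growth: "\<And>s t x. 0 \<le> s \<Longrightarrow> s \<le> t \<Longrightarrow> norm (U t s x) \<le> exp (k * (t - s)) * norm x"
  shows "continuous_on {s..} (\<lambda>t. adjoint (U t s) v)"
proof -
  define F where "F p = (case p of (b, a) \<Rightarrow>
      ((exp (k * (b - a)))\<^sup>2 + 1) * (norm v)\<^sup>2 - 2 * (U b a v \<bullet> v))" for p :: "real \<times> real"
  have F_cont: "continuous_on {(b, a). 0 \<le> a \<and> a \<le> b} F"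
  proof -
    let ?P = "{(t, s). 0 \<le> s \<and> s \<le> t} :: (real \<times> real) set"
    have "continuous_on ?P (\<lambda>p. U (fst p) (snd p) v)"
      using U by (simp add: evolution_system_def case_prod_beta')
    then have "continuous_on ?P (\<lambda>p. 2 * (U (fst p) (snd p) v \<bullet> v))"
      by (intro continuous_on_mult continuous_on_inner continuous_on_const)
    moreover have "continuous_on ?P
        (\<lambda>p. ((exp (k * (fst p - snd p)))\<^sup>2 + 1) * (norm v)\<^sup>2)"
      by (intro continuous_intros)
    ultimately show ?thesis
      unfolding F_def case_prod_beta' by (rule continuous_on_diff[rotated])
  qed
  have step: "(norm (adjoint (U b s) v - adjoint (U a s) v))\<^sup>2
      \<le> (exp (k * (a - s)))\<^sup>2 * F (b, a)" if "s \<le> a" "a \<le> b" for a b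
  proof -
    have "U b s = U b a o\<^sub>L U a s"
      using U \<open>0 \<le> s\<close> that by (simp add: evolution_system_def)
    then have "adjoint (U b s) v - adjoint (U a s) v = adjoint (U a s) (adjoint (U b a) v - v)"
      by (simp only: adjoint_compose adjoint_diff_right)
    then have "norm (adjoint (U b s) v - adjoint (U a s) v)
        \<le> exp (k * (a - s)) * norm (adjoint (U b a) v - v)"
      using growth \<open>0 \<le> s\<close> that by (simp add: norm_adjoint_le_bound)
    then have "(norm (adjoint (U b s) v - adjoint (U a s) v))\<^sup>2
        \<le> (exp (k * (a - s)) * norm (adjoint (U b a) v - v))\<^sup>2"
      by (intro power_mono) auto
    also have "\<dots> = (exp (k * (a - s)))\<^sup>2 * (norm (adjoint (U b a) v - v))\<^sup>2"
      by (rule power_mult_distrib)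
    also have "\<dots> \<le> (exp (k * (a - s)))\<^sup>2 * F (b, a)"
      unfolding F_def prod.case
      using growth[of a b] \<open>0 \<le> s\<close> that
      by (intro mult_left_mono quasi_contraction_adjoint_displacement) auto
    finally show ?thesis .
  qed
  show ?thesis
    unfolding continuous_on_sequentially
  proof (intro allI ballI impI, elim conjE)
    fix w t
    assume t: "t \<in> {s..}" and w: "\<forall>n. w n \<in> {s..}" and lim: "w \<longlonglongrightarrow> t"
    \<comment> \<open>Ordering the pair \<open>w n\<close>, \<open>t\<close> treats approach from the left and from the right together.\<close>
    define a where "a n = min (w n) t" for n
    define b where "b n = max (w n) t" for n
    have a_lim: "a \<longlonglongrightarrow> t" and b_lim: "b \<longlonglongrightarrow> t"
      using tendsto_min[OF lim tendsto_const[of t]] tendsto_max[OF lim tendsto_const[of t]]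
      by (simp_all add: a_def[abs_def] b_def[abs_def])
    have ab: "s \<le> a n" "a n \<le> b n" "a n \<le> t" for n
      using w t by (auto simp: a_def b_def)
    have "(\<lambda>n. F (b n, a n)) \<longlonglongrightarrow> F (t, t)"
    proof (rule continuous_on_tendsto_compose[OF F_cont tendsto_Pair[OF b_lim a_lim]])
      have "0 \<le> a n" for n
        using ab(1) \<open>0 \<le> s\<close> by (rule order_trans[rotated])
      then show "\<forall>\<^sub>F n in sequentially. (b n, a n) \<in> {(b, a). 0 \<le> a \<and> a \<le> b}"
        using ab(2) by (simp add: always_eventually)
    qed (use t \<open>0 \<le> s\<close> in auto)
    moreover have "F (t, t) = 0"
      using U t \<open>0 \<le> s\<close> by (simp add: F_def evolution_system_def power2_norm_eq_inner)
    ultimately have "(\<lambda>n. (exp (k * (a n - s)))\<^sup>2 * F (b n, a n))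
        \<longlonglongrightarrow> (exp (k * (t - s)))\<^sup>2 * 0"
      by (intro tendsto_mult tendsto_power tendsto_exp tendsto_diff tendsto_const a_lim) simp
    then have "(\<lambda>n. (exp (k * (a n - s)))\<^sup>2 * F (b n, a n)) \<longlonglongrightarrow> 0"
      by (simp only: mult_zero_right)
    moreover have "\<forall>\<^sub>F n in sequentially.
        norm ((norm (adjoint (U (b n) s) v - adjoint (U (a n) s) v))\<^sup>2)
        \<le> (exp (k * (a n - s)))\<^sup>2 * F (b n, a n)"
      using step[OF ab(1,2)] by (simp add: always_eventually)
    ultimately have "(\<lambda>n. (norm (adjoint (U (b n) s) v - adjoint (U (a n) s) v))\<^sup>2) \<longlonglongrightarrow> 0"
      by (rule Lim_null_comparison[rotated])
    then have "(\<lambda>n. sqrt ((norm (adjoint (U (b n) s) v - adjoint (U (a n) s) v))\<^sup>2))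
        \<longlonglongrightarrow> sqrt 0"
      by (rule tendsto_real_sqrt)
    moreover have "norm (adjoint (U (b n) s) v - adjoint (U (a n) s) v)
        = norm (adjoint (U (w n) s) v - adjoint (U t s) v)" for n
      by (simp add: a_def b_def min_def max_def norm_minus_commute)
    ultimately have "(\<lambda>n. norm (adjoint (U (w n) s) v - adjoint (U t s) v)) \<longlonglongrightarrow> 0"
      by simp
    then show "((\<lambda>t. adjoint (U t s) v) \<circ> w) \<longlonglongrightarrow> adjoint (U t s) v"
      unfolding comp_def Lim_null[of _ "adjoint (U t s) v"] by (rule tendsto_norm_zero_cancel)
  qed
qed

lemma uniform_limit_adjoint:
  fixes U :: "'i \<Rightarrow> 's \<Rightarrow> 'a::{real_inner,banach} \<Rightarrow>\<^sub>L 'b::real_inner"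
  assumes "uniform_limit S U V F"
  shows "uniform_limit S (\<lambda>n t. adjoint (U n t) v) (\<lambda>t. adjoint (V t) v) F"
proof (rule uniform_limitI)
  fix e :: real
  assume "0 < e"
  then have "0 < e / (norm v + 1)"
    by (simp add: add_nonneg_pos)
  from uniform_limitD[OF assms this]
  show "\<forall>\<^sub>F n in F. \<forall>t\<in>S. dist (adjoint (U n t) v) (adjoint (V t) v) < e"
  proof (eventually_elim, intro ballI)
    fix n t
    assume "\<forall>t\<in>S. dist (U n t) (V t) < e / (norm v + 1)" and "t \<in> S"
    then have close: "norm (U n t - V t) * (norm v + 1) < e"
      by (simp add: dist_norm pos_less_divide_eq add_nonneg_pos)
    have "dist (adjoint (U n t) v) (adjoint (V t) v) = norm (adjoint (U n t - V t) v)"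
      by (simp add: dist_norm adjoint_diff_left)
    also have "\<dots> \<le> norm (U n t - V t) * norm v"
      by (intro norm_adjoint_le_bound norm_blinfun) simp
    also have "\<dots> \<le> norm (U n t - V t) * (norm v + 1)"
      by (intro mult_left_mono) auto
    finally show "dist (adjoint (U n t) v) (adjoint (V t) v) < e"
      using close by linarith
  qed
qed

text \<open>Growth bound and strong continuity of the adjoint are inherited by \<open>\<lambda>t. U t 0\<close> from the shifted
evolutions, by pointwise and by locally uniform convergence respectively.\<close>

lemma limit_evolution_growth:
  fixes T :: "real \<Rightarrow> real \<Rightarrow> 'a::real_normed_vector \<Rightarrow>\<^sub>L 'a"
  assumes lim: "\<And>\<tau>. 0 \<le> \<tau> \<Longrightarrow>
      uniform_limit {0..\<tau>} (\<lambda>n t. T (tn n + t) (tn n)) (\<lambda>t. U t 0) sequentially"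
    and growth: "\<And>s t x. 0 \<le> s \<Longrightarrow> s \<le> t \<Longrightarrow> norm (T t s x) \<le> exp (k * (t - s)) * norm x"
    and "\<And>n. 0 \<le> tn n" and "0 \<le> t"
  shows "norm (U t 0 x) \<le> exp (k * t) * norm x"
proof (rule tendsto_upperbound)
  have "(\<lambda>n. T (tn n + t) (tn n)) \<longlonglongrightarrow> U t 0"
    using tendsto_uniform_limitI[OF lim[OF \<open>0 \<le> t\<close>], of t] \<open>0 \<le> t\<close> by simp
  then show "(\<lambda>n. norm (T (tn n + t) (tn n) x)) \<longlonglongrightarrow> norm (U t 0 x)"
    by (intro tendsto_norm blinfun.tendsto tendsto_const)
  show "\<forall>\<^sub>F n in sequentially. norm (T (tn n + t) (tn n) x) \<le> exp (k * t) * norm x"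
  proof (intro always_eventually allI)
    fix n
    show "norm (T (tn n + t) (tn n) x) \<le> exp (k * t) * norm x"
      using growth[of "tn n" "tn n + t"] assms(3,4) by simp
  qed
qed simp

lemma limit_evolution_adjoint_continuous:
  fixes T :: "real \<Rightarrow> real \<Rightarrow> 'a::{real_inner,banach} \<Rightarrow>\<^sub>L 'a"
  assumes lim: "\<And>\<tau>. 0 \<le> \<tau> \<Longrightarrow>
      uniform_limit {0..\<tau>} (\<lambda>n t. T (tn n + t) (tn n)) (\<lambda>t. U t 0) sequentially"
    and growth: "\<And>s t x. 0 \<le> s \<Longrightarrow> s \<le> t \<Longrightarrow> norm (T t s x) \<le> exp (k * (t - s)) * norm x"
    and T: "evolution_system T" and "0 \<le> k" and "\<And>n. 0 \<le> tn n"
  shows "continuous_on {0..\<tau>} (\<lambda>t. adjoint (U t 0) v)"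
proof (cases "0 \<le> \<tau>")
  case True
  have "continuous_on {0..\<tau>} (\<lambda>t. adjoint (T (tn n + t) (tn n)) v)" for n
    by (rule continuous_on_compose2[OF quasi_contractive_adjoint_continuous[OF T]])
      (use assms in \<open>auto intro!: continuous_intros\<close>)
  then show ?thesis
    by (intro uniform_limit_theorem[OF _ uniform_limit_adjoint[OF lim[OF True]]])
      (auto intro: always_eventually)
qed simp

section \<open>The gramian and the observable subspace\<close>

text \<open>Continuity in norm makes the gramian a convergent integral, which commutes with inner products.\<close>

lemma gramian_integrand_continuous:
  fixes U :: "real \<Rightarrow> real \<Rightarrow> 'a::{real_inner,banach} \<Rightarrow>\<^sub>L 'a"
    and C :: "'a \<Rightarrow>\<^sub>L 'b::{real_inner,banach}"
  assumes adj: "\<And>v. continuous_on {0..\<tau>} (\<lambda>t. adjoint (U t 0) v)"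
    and bound: "\<And>t x. t \<in> {0..\<tau>} \<Longrightarrow> norm (U t 0 x) \<le> B * norm x" and "0 \<le> B"
    and U: "evolution_system U"
  shows "continuous_on {0..\<tau>} (\<lambda>t. adjoint (U t 0) (adjoint C (C (U t 0 z))))"
proof -
  define g where "g t = adjoint C (C (U t 0 z))" for t
  have CU: "continuous_on {0..\<tau>} (\<lambda>t. C (U t 0 z))"
    by (rule evolution_output_continuous[OF U]) auto
  show ?thesis
    unfolding g_def[symmetric] continuous_on_def
  proof
    fix t
    assume t: "t \<in> {0..\<tau>}"
    let ?F = "at t within {0..\<tau>}"
    have "((\<lambda>s. C (U s 0 z)) \<longlongrightarrow> C (U t 0 z)) ?F"
      using CU t by (simp add: continuous_on_def)
    then have "((\<lambda>s. norm C * norm (C (U s 0 z) - C (U t 0 z))) \<longlongrightarrow>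
        norm C * norm (C (U t 0 z) - C (U t 0 z))) ?F"
      by (intro tendsto_mult tendsto_norm tendsto_diff tendsto_const)
    then have "((\<lambda>s. B * (norm C * norm (C (U s 0 z) - C (U t 0 z)))) \<longlongrightarrow> 0) ?F"
      by (auto intro: tendsto_mult_right_zero)
    moreover have "\<forall>\<^sub>F s in ?F. norm (adjoint (U s 0) (g s) - adjoint (U s 0) (g t))
        \<le> B * (norm C * norm (C (U s 0 z) - C (U t 0 z)))"
    proof (unfold eventually_at_filter, intro always_eventually allI impI)
      fix s
      assume "s \<in> {0..\<tau>}"
      then have "norm (adjoint (U s 0) (g s - g t)) \<le> B * norm (g s - g t)"
        using bound \<open>0 \<le> B\<close> by (intro norm_adjoint_le_bound) auto
      also have "norm (g s - g t) \<le> norm C * norm (C (U s 0 z) - C (U t 0 z))"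
        unfolding g_def adjoint_diff_right[symmetric]
        by (intro norm_adjoint_le_bound norm_blinfun) simp
      finally show "norm (adjoint (U s 0) (g s) - adjoint (U s 0) (g t))
          \<le> B * (norm C * norm (C (U s 0 z) - C (U t 0 z)))"
        using \<open>0 \<le> B\<close> by (simp add: adjoint_diff_right mult_left_mono)
    qed
    ultimately have "((\<lambda>s. adjoint (U s 0) (g s) - adjoint (U s 0) (g t)) \<longlongrightarrow> 0) ?F"
      by (rule Lim_null_comparison[rotated])
    moreover have "((\<lambda>s. adjoint (U s 0) (g t)) \<longlongrightarrow> adjoint (U t 0) (g t)) ?F"
      using adj t by (auto simp: continuous_on_def)
    ultimately have "((\<lambda>s. (adjoint (U s 0) (g s) - adjoint (U s 0) (g t)) + adjoint (U s 0) (g t))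
        \<longlongrightarrow> 0 + adjoint (U t 0) (g t)) ?F"
      by (rule tendsto_add)
    then show "((\<lambda>s. adjoint (U s 0) (g s)) \<longlongrightarrow> adjoint (U t 0) (g t)) ?F"
      by simp
  qed
qed

lemma inner_obs_gramian:
  fixes U :: "real \<Rightarrow> real \<Rightarrow> 'a::{real_inner,banach} \<Rightarrow>\<^sub>L 'a"
    and C :: "'a \<Rightarrow>\<^sub>L 'b::{real_inner,banach}"
  assumes "continuous_on {0..\<tau>} (\<lambda>t. adjoint (U t 0) (adjoint C (C (U t 0 z))))"
  shows "x \<bullet> obs_gramian U C \<tau> z = integral {0..\<tau>} (\<lambda>t. C (U t 0 x) \<bullet> C (U t 0 z))"
  using integral_linear[OF integrable_continuous_real[OF assms] bounded_linear_inner_right[of x]]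
  by (simp add: obs_gramian_def comp_def inner_adjoint)

text \<open>The quadratic form of the gramian is the output energy, the integral of a continuous nonnegative
function. Hence the kernel consists of the states that produce no output up to time \<open>\<tau>\<close>.\<close>

lemma obs_gramian_eq_0_iff:
  fixes U :: "real \<Rightarrow> real \<Rightarrow> 'a::{real_inner,banach} \<Rightarrow>\<^sub>L 'a"
    and C :: "'a \<Rightarrow>\<^sub>L 'b::{real_inner,banach}"
  assumes cont: "continuous_on {0..\<tau>} (\<lambda>t. adjoint (U t 0) (adjoint C (C (U t 0 z))))"
    and U: "evolution_system U" and "0 < \<tau>"
  shows "z \<bullet> obs_gramian U C \<tau> z = 0 \<longleftrightarrow> (\<forall>t\<in>{0..\<tau>}. C (U t 0 z) = 0)"
    and "obs_gramian U C \<tau> z = 0 \<longleftrightarrow> (\<forall>t\<in>{0..\<tau>}. C (U t 0 z) = 0)"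
proof -
  have CU: "continuous_on {0..\<tau>} (\<lambda>t. C (U t 0 z))"
    by (rule evolution_output_continuous[OF U]) auto
  have "integral {0..\<tau>} (\<lambda>t. C (U t 0 z) \<bullet> C (U t 0 z)) = 0
      \<longleftrightarrow> (\<forall>t\<in>{0..\<tau>}. C (U t 0 z) \<bullet> C (U t 0 z) = 0)"
    using \<open>0 < \<tau>\<close> by (intro integral_eq_0_iff continuous_intros CU) auto
  then show *: "z \<bullet> obs_gramian U C \<tau> z = 0 \<longleftrightarrow> (\<forall>t\<in>{0..\<tau>}. C (U t 0 z) = 0)"
    by (simp add: inner_obs_gramian[where U = U and C = C and z = z, OF cont])
  have "(\<forall>t\<in>{0..\<tau>}. C (U t 0 z) = 0) \<Longrightarrow> obs_gramian U C \<tau> z = 0"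
  proof -
    assume "\<forall>t\<in>{0..\<tau>}. C (U t 0 z) = 0"
    then have "adjoint (U t 0) (adjoint C (C (U t 0 z))) = 0" if "t \<in> {0..\<tau>}" for t
      using adjoint_diff_right[of "U t 0" 0 0] adjoint_diff_right[of C 0 0] that by simp
    then show "obs_gramian U C \<tau> z = 0"
      unfolding obs_gramian_def by (intro integral_unique has_integral_is_0)
  qed
  then show "obs_gramian U C \<tau> z = 0 \<longleftrightarrow> (\<forall>t\<in>{0..\<tau>}. C (U t 0 z) = 0)"
    using * by auto
qed

text \<open>The gramian is symmetric, so the complement of its kernel is the closure of its range. For the inclusion it
is enough that a vector \<open>u\<close> orthogonal to its own image \<open>W u\<close> lies in the kernel.\<close>

lemma orthogonal_comp_gramian_kernel_subset:
  fixes U :: "real \<Rightarrow> real \<Rightarrow> 'a::{real_inner,banach} \<Rightarrow>\<^sub>L 'a"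
    and C :: "'a \<Rightarrow>\<^sub>L 'b::{real_inner,banach}"
  assumes cont: "\<And>z. continuous_on {0..\<tau>} (\<lambda>t. adjoint (U t 0) (adjoint C (C (U t 0 z))))"
    and U: "evolution_system U" and "0 < \<tau>"
  shows "orthogonal_comp {z. obs_gramian U C \<tau> z = 0} \<subseteq> closure (span (range (obs_gramian U C \<tau>)))"
proof -
  have "orthogonal_comp (span (range (obs_gramian U C \<tau>))) \<subseteq> {z. obs_gramian U C \<tau> z = 0}"
  proof
    fix u
    assume "u \<in> orthogonal_comp (span (range (obs_gramian U C \<tau>)))"
    then have "u \<bullet> obs_gramian U C \<tau> u = 0"
      by (auto simp: orthogonal_comp_def orthogonal_def inner_commute span_base)
    then show "u \<in> {z. obs_gramian U C \<tau> z = 0}"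
      using obs_gramian_eq_0_iff[OF cont U \<open>0 < \<tau>\<close>] by simp
  qed
  from orthogonal_comp_anti_mono[OF this] show ?thesis
    using double_orthogonal_comp_subset_closure[OF subspace_span] by blast
qed

text \<open>The kernels shrink as \<open>\<tau>\<close> grows, so their complements form an increasing family of subspaces, whose union
is a subspace.\<close>

lemma observable_subspace_subspace:
  fixes U :: "real \<Rightarrow> real \<Rightarrow> 'a::{real_inner,banach} \<Rightarrow>\<^sub>L 'a"
    and C :: "'a \<Rightarrow>\<^sub>L 'b::{real_inner,banach}"
  assumes cont: "\<And>\<tau> z. continuous_on {0..\<tau>} (\<lambda>t. adjoint (U t 0) (adjoint C (C (U t 0 z))))"
    and U: "evolution_system U"
  shows "subspace (observable_subspace U C)"
  unfolding observable_subspace_def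
proof (rule subspace_closure)
  define P where "P \<tau> = orthogonal_comp {z. obs_gramian U C \<tau> z = 0}" for \<tau>
  have P: "subspace (P \<tau>)" for \<tau>
    by (simp add: P_def subspace_orthogonal_comp)
  have mono: "P \<sigma> \<subseteq> P \<tau>" if "0 < \<sigma>" "\<sigma> \<le> \<tau>" for \<sigma> \<tau>
    unfolding P_def using that
    by (intro orthogonal_comp_anti_mono) (auto simp: obs_gramian_eq_0_iff[OF cont U])
  show "subspace (\<Union>\<tau>\<in>{0<..}. orthogonal_comp {z. obs_gramian U C \<tau> z = 0})"
    unfolding P_def[symmetric] subspace_def
  proof (intro conjI ballI allI)
    show "0 \<in> (\<Union>\<tau>\<in>{0<..}. P \<tau>)"
      using subspace_0[OF P[of 1]] by (auto intro: bexI[of _ 1])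
  next
    fix x y
    assume "x \<in> (\<Union>\<tau>\<in>{0<..}. P \<tau>)" "y \<in> (\<Union>\<tau>\<in>{0<..}. P \<tau>)"
    then obtain \<sigma> \<tau> where "0 < \<sigma>" "0 < \<tau>" "x \<in> P \<sigma>" "y \<in> P \<tau>"
      by auto
    then have "x \<in> P (max \<sigma> \<tau>)" "y \<in> P (max \<sigma> \<tau>)"
      using mono[of \<sigma> "max \<sigma> \<tau>"] mono[of \<tau> "max \<sigma> \<tau>"] by auto
    then show "x + y \<in> (\<Union>\<tau>\<in>{0<..}. P \<tau>)"
      using subspace_add[OF P] \<open>0 < \<sigma>\<close> by (auto intro!: bexI[of _ "max \<sigma> \<tau>"])
  next
    fix c x
    assume "x \<in> (\<Union>\<tau>\<in>{0<..}. P \<tau>)"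
    then show "c *\<^sub>R x \<in> (\<Union>\<tau>\<in>{0<..}. P \<tau>)"
      using subspace_scale[OF P] by blast
  qed
qed

text \<open>The vectors \<open>x n\<close> start limit trajectories that are uniformly close to curves \<open>y n\<close> with vanishing output
energy. Hence the outputs of the limit trajectories are small in the mean, and \<open>x n \<bullet> W z\<close> is the
integral of these outputs against the fixed output of \<open>z\<close>.\<close>

lemma output_small_implies_gramian_null:
  fixes U :: "real \<Rightarrow> real \<Rightarrow> 'a::{real_inner,banach} \<Rightarrow>\<^sub>L 'a"
    and C :: "'a \<Rightarrow>\<^sub>L 'b::{real_inner,banach}"
  assumes cont: "continuous_on {0..\<tau>} (\<lambda>t. adjoint (U t 0) (adjoint C (C (U t 0 z))))"
    and U: "evolution_system U" and "0 \<le> \<tau>"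
    and y_cont: "\<And>n. continuous_on {0..\<tau>} (y n)"
    and close: "uniform_limit {0..\<tau>} (\<lambda>n s. y n s - U s 0 (x n)) (\<lambda>_. 0) sequentially"
    and energy: "(\<lambda>n. integral {0..\<tau>} (\<lambda>s. (norm (C (y n s)))\<^sup>2)) \<longlonglongrightarrow> 0"
  shows "(\<lambda>n. x n \<bullet> obs_gramian U C \<tau> z) \<longlonglongrightarrow> 0"
  unfolding tendsto_iff
proof (intro allI impI)
  fix e :: real
  assume "0 < e"
  have Uz: "continuous_on {0..\<tau>} (\<lambda>s. C (U s 0 z))"
    by (rule evolution_output_continuous[OF U]) auto
  have Ux: "continuous_on {0..\<tau>} (\<lambda>s. C (U s 0 (x n)))" for n
    by (rule evolution_output_continuous[OF U]) auto
  have Cy: "continuous_on {0..\<tau>} (\<lambda>s. C (y n s))" for n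
    by (intro bounded_linear.continuous_on[OF blinfun.bounded_linear_right] y_cont)
  obtain B where B: "0 < B" "\<And>s. s \<in> {0..\<tau>} \<Longrightarrow> norm (C (U s 0 z)) \<le> B"
    using compact_imp_bounded[OF compact_continuous_image[OF Uz compact_Icc]]
    unfolding bounded_pos by auto
  \<comment> \<open>With closeness \<open>\<eta>\<close> and output energy below \<open>\<eta>\<^sup>2\<close> the bound below comes out as \<open>c * \<eta>\<close>.\<close>
  define c where "c = B * (1 + \<tau> + norm C * \<tau>)"
  have "0 < c"
    using B(1) \<open>0 \<le> \<tau>\<close> by (simp add: c_def add_pos_nonneg)
  define \<eta> where "\<eta> = e / (2 * c)"
  have "0 < \<eta>"
    using \<open>0 < e\<close> \<open>0 < c\<close> by (simp add: \<eta>_def)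
  have "\<forall>\<^sub>F n in sequentially. integral {0..\<tau>} (\<lambda>s. (norm (C (y n s)))\<^sup>2) < \<eta>\<^sup>2"
    using energy by (rule order_tendstoD) (use \<open>0 < \<eta>\<close> in simp)
  then show "\<forall>\<^sub>F n in sequentially. dist (x n \<bullet> obs_gramian U C \<tau> z) 0 < e"
    using uniform_limitD[OF close \<open>0 < \<eta>\<close>]
  proof eventually_elim
    case (elim n)
    let ?g = "\<lambda>s. B * (\<eta> + (norm (C (y n s)))\<^sup>2 / \<eta> + norm C * \<eta>)"
    have pointwise: "norm (C (U s 0 (x n)) \<bullet> C (U s 0 z)) \<le> ?g s" if s: "s \<in> {0..\<tau>}" for s
    proof -
      have "C (U s 0 (x n)) = C (y n s) - C (y n s - U s 0 (x n))"
        by (simp add: blinfun.diff_right)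
      then have "norm (C (U s 0 (x n))) \<le> norm (C (y n s)) + norm (C (y n s - U s 0 (x n)))"
        by (metis norm_triangle_ineq4)
      also have "norm (C (y n s - U s 0 (x n))) \<le> norm C * norm (y n s - U s 0 (x n))"
        by (rule norm_blinfun)
      also have "\<dots> \<le> norm C * \<eta>"
        using elim(2) s by (intro mult_left_mono) (auto simp: less_imp_le)
      \<comment> \<open>This replaces the Cauchy-Schwarz inequality in passing from square means to means.\<close>
      also have "norm (C (y n s)) \<le> \<eta> + (norm (C (y n s)))\<^sup>2 / \<eta>"
      proof (cases "norm (C (y n s)) \<le> \<eta>")
        case True
        then show ?thesis
          using \<open>0 < \<eta>\<close> by (simp add: add_increasing2)
      next
        case False
        then have "norm (C (y n s)) \<le> (norm (C (y n s)))\<^sup>2 / \<eta>"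
          using \<open>0 < \<eta>\<close> by (simp add: pos_le_divide_eq power2_eq_square mult_left_mono)
        then show ?thesis
          using \<open>0 < \<eta>\<close> by simp
      qed
      finally have bound: "norm (C (U s 0 (x n))) \<le> \<eta> + (norm (C (y n s)))\<^sup>2 / \<eta> + norm C * \<eta>"
        by simp
      have "norm (C (U s 0 (x n)) \<bullet> C (U s 0 z)) \<le> norm (C (U s 0 (x n))) * norm (C (U s 0 z))"
        by (simp add: Cauchy_Schwarz_ineq2)
      also have "\<dots> \<le> (\<eta> + (norm (C (y n s)))\<^sup>2 / \<eta> + norm C * \<eta>) * B"
        using bound B(2)[OF s] by (intro mult_mono) (auto intro: order_trans[OF norm_ge_zero])
      finally show ?thesis
        by (simp add: mult.commute)
    qed
    have Iy: "(\<lambda>s. (norm (C (y n s)))\<^sup>2) integrable_on {0..\<tau>}"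
      by (intro integrable_continuous_real continuous_on_power continuous_on_norm Cy)
    have "((\<lambda>s. \<eta> + (norm (C (y n s)))\<^sup>2 / \<eta> + norm C * \<eta>) has_integral
        (\<tau> * \<eta> + integral {0..\<tau>} (\<lambda>s. (norm (C (y n s)))\<^sup>2) / \<eta> + \<tau> * (norm C * \<eta>))) {0..\<tau>}"
      using \<open>0 \<le> \<tau>\<close> integrable_integral[OF Iy]
        has_integral_const_real[of \<eta> 0 \<tau>] has_integral_const_real[of "norm C * \<eta>" 0 \<tau>]
      by (intro has_integral_add has_integral_divide) auto
    then have g_int: "(?g has_integral
        B * (\<tau> * \<eta> + integral {0..\<tau>} (\<lambda>s. (norm (C (y n s)))\<^sup>2) / \<eta> + \<tau> * (norm C * \<eta>))) {0..\<tau>}"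
      by (rule has_integral_mult_right)
    have "norm (x n \<bullet> obs_gramian U C \<tau> z)
        = norm (integral {0..\<tau>} (\<lambda>s. C (U s 0 (x n)) \<bullet> C (U s 0 z)))"
      by (simp add: inner_obs_gramian[where U = U and C = C and z = z, OF cont])
    also have "\<dots> \<le> integral {0..\<tau>} ?g"
      using pointwise
      by (intro integral_norm_bound_integral has_integral_integrable[OF g_int]
          integrable_continuous_real continuous_on_inner Ux Uz) auto
    also have "\<dots> = B * (\<tau> * \<eta> + integral {0..\<tau>} (\<lambda>s. (norm (C (y n s)))\<^sup>2) / \<eta>
        + \<tau> * (norm C * \<eta>))"
      using g_int by (rule integral_unique)
    also have "\<dots> \<le> B * (\<tau> * \<eta> + \<eta> + \<tau> * (norm C * \<eta>))"
      using elim(1) B(1) \<open>0 < \<eta>\<close> \<open>0 \<le> \<tau>\<close>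
      by (intro mult_left_mono add_mono) (auto simp: pos_divide_le_eq power2_eq_square)
    also have "\<dots> = c * \<eta>"
      by (simp add: c_def algebra_simps)
    also have "\<dots> < e"
      using \<open>0 < c\<close> \<open>0 < e\<close> by (simp add: \<eta>_def)
    finally show ?case
      by simp
  qed
qed

section \<open>Convergence of the observer error\<close>

text \<open>The deviation splits into that of the observer error from the free evolution and that of the free evolution
from its limit, the latter being applied to the bounded vectors \<open>S (tn n) 0 x\<close>.\<close>

lemma observer_error_follows_limit_evolution:
  fixes C :: "'a::{real_inner,banach} \<Rightarrow>\<^sub>L 'b::{real_inner,banach}"
  assumes wd: "weakly_detectable \<mu> D A C" and "0 \<le> \<mu>" and "\<mu> < r" and "closure D = UNIV"
    and gen: "\<And>t. 0 \<le> t \<Longrightarrow> generates_c0_semigroup D (A t)"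
    and T: "generates_evolution_system D A T"
    and S: "generates_evolution_system D (\<lambda>t x. A t x - r *\<^sub>R adjoint C (C x)) S"
    and "x \<in> D" and "0 \<le> L"
    and lim: "uniform_limit {0..L} (\<lambda>n t. T (tn n + t) (tn n)) (\<lambda>t. U t 0) sequentially"
    and tn: "filterlim tn at_top sequentially" "\<And>n. 0 \<le> tn n"
  shows "uniform_limit {0..L} (\<lambda>n s. S (tn n + s) 0 x - U s 0 (S (tn n) 0 x)) (\<lambda>_. 0) sequentially"
proof (rule uniform_limitI)
  fix e :: real
  assume "0 < e"
  then have "0 < e / 2" and "0 < e / 2 / (norm x + 1)"
    by (simp_all add: add_nonneg_pos)
  have "\<forall>\<^sub>F t in at_top. \<forall>s\<in>{0..L}. dist (S (t + s) 0 x - T (t + s) t (S t 0 x)) 0 < e / 2"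
    using assms \<open>0 < e / 2\<close>
    by (intro uniform_limitD[OF observer_error_asymptotically_free[OF wd]]) auto
  then have "\<forall>\<^sub>F n in sequentially. \<forall>s\<in>{0..L}.
      dist (S (tn n + s) 0 x - T (tn n + s) (tn n) (S (tn n) 0 x)) 0 < e / 2"
    using tn(1) by (rule eventually_compose_filterlim)
  then show "\<forall>\<^sub>F n in sequentially. \<forall>s\<in>{0..L}.
      dist (S (tn n + s) 0 x - U s 0 (S (tn n) 0 x)) 0 < e"
    using uniform_limitD[OF lim \<open>0 < e / 2 / (norm x + 1)\<close>]
  proof (eventually_elim, intro ballI)
    fix n s
    assume free: "\<forall>s\<in>{0..L}. dist (S (tn n + s) 0 x - T (tn n + s) (tn n) (S (tn n) 0 x)) 0 < e / 2"
      and T_close: "\<forall>s\<in>{0..L}. dist (T (tn n + s) (tn n)) (U s 0) < e / 2 / (norm x + 1)"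
      and s: "s \<in> {0..L}"
    let ?T = "T (tn n + s) (tn n)"
    have "norm (?T (S (tn n) 0 x) - U s 0 (S (tn n) 0 x))
        \<le> norm (?T - U s 0) * norm (S (tn n) 0 x)"
      by (simp add: blinfun.diff_left[symmetric] norm_blinfun)
    also have "\<dots> \<le> e / 2 / (norm x + 1) * (norm x + 1)"
    proof (rule mult_mono)
      show "norm (?T - U s 0) \<le> e / 2 / (norm x + 1)"
        using T_close s by (simp add: dist_norm less_imp_le)
      show "norm (S (tn n) 0 x) \<le> norm x + 1"
        using observer_error_contraction[OF wd \<open>\<mu> < r\<close> \<open>closure D = UNIV\<close> S tn(2), of n x]
        by simp
      show "0 \<le> e / 2 / (norm x + 1)"
        using \<open>0 < e / 2 / (norm x + 1)\<close> by (rule less_imp_le)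
    qed simp
    also have "\<dots> = e / 2"
      using norm_ge_zero[of x] by (intro nonzero_eq_divide_eq[THEN iffD1]) linarith+
    finally have "norm (?T (S (tn n) 0 x) - U s 0 (S (tn n) 0 x)) \<le> e / 2" .
    moreover have "norm (S (tn n + s) 0 x - ?T (S (tn n) 0 x)) < e / 2"
      using free s by simp
    ultimately have "norm ((S (tn n + s) 0 x - ?T (S (tn n) 0 x))
        + (?T (S (tn n) 0 x) - U s 0 (S (tn n) 0 x))) < e"
      by (intro norm_triangle_lt) simp
    then show "dist (S (tn n + s) 0 x - U s 0 (S (tn n) 0 x)) 0 < e"
      by simp
  qed
qed

text \<open>The error evolution is a contraction, so weak decay for initial errors in \<open>D\<close> extends to all of them.\<close>

lemma observer_error_null_of_dense:
  fixes C :: "'a::{real_inner,banach} \<Rightarrow>\<^sub>L 'b::{real_inner,banach}"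
  assumes wd: "weakly_detectable \<mu> D A C" and "\<mu> < r" and "closure D = UNIV"
    and S: "generates_evolution_system D (\<lambda>t x. A t x - r *\<^sub>R adjoint C (C x)) S"
    and times: "\<forall>\<^sub>F i in F. 0 \<le> \<theta> i"
    and null: "\<And>x. x \<in> D \<Longrightarrow> ((\<lambda>i. S (\<theta> i) 0 x \<bullet> v) \<longlongrightarrow> 0) F"
  shows "((\<lambda>i. S (\<theta> i) 0 x \<bullet> v) \<longlongrightarrow> 0) F"
proof (rule null_functionals_on_closure_span[where G = D and B = "norm v"
      and f = "\<lambda>i x. S (\<theta> i) 0 x \<bullet> v"])
  show "linear (\<lambda>x. S (\<theta> i) 0 x \<bullet> v)" for i
    by (intro linearI) (simp_all add: blinfun.add_right blinfun.scaleR_right inner_add_left)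
  show "\<forall>\<^sub>F i in F. \<forall>x. \<bar>S (\<theta> i) 0 x \<bullet> v\<bar> \<le> norm v * norm x"
    using times
  proof (eventually_elim, intro allI)
    fix i x
    assume "0 \<le> \<theta> i"
    have "\<bar>S (\<theta> i) 0 x \<bullet> v\<bar> \<le> norm (S (\<theta> i) 0 x) * norm v"
      by (rule Cauchy_Schwarz_ineq2)
    also have "\<dots> \<le> norm x * norm v"
      using observer_error_contraction[OF wd \<open>\<mu> < r\<close> \<open>closure D = UNIV\<close> S \<open>0 \<le> \<theta> i\<close>]
      by (intro mult_right_mono) auto
    finally show "\<bar>S (\<theta> i) 0 x \<bullet> v\<bar> \<le> norm v * norm x"
      by (simp add: mult.commute)
  qed
  show "x \<in> closure (span D)"
    using closure_mono[OF span_superset[of D]] \<open>closure D = UNIV\<close> by auto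
qed (fact null)

lemma bounded_gaps_cover:
  fixes u :: "nat \<Rightarrow> real"
  assumes "incseq u" and "filterlim u at_top sequentially"
    and gap: "\<And>n. u (Suc n) - u n \<le> L" and "u N \<le> t"
  obtains n where "n \<ge> N" and "t - u n \<in> {0..L}"
proof -
  obtain m where "m \<ge> N" "t < u m"
    using assms(2) unfolding filterlim_at_top_dense eventually_sequentially
    by (meson linorder_le_cases order_refl)
  define n where "n = (LEAST n. n \<ge> N \<and> t < u (Suc n))"
  have "\<exists>n. n \<ge> N \<and> t < u (Suc n)"
    using \<open>m \<ge> N\<close> \<open>t < u m\<close> assms(1) by (metis incseq_SucD less_le_trans)
  then have n: "n \<ge> N" "t < u (Suc n)"
    using LeastI_ex[of "\<lambda>n. n \<ge> N \<and> t < u (Suc n)"] by (simp_all add: n_def)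
  have "u n \<le> t"
  proof (cases "n = N")
    case False
    then obtain j where j: "n = Suc j" "j \<ge> N"
      using n(1) by (cases n) auto
    then have "\<not> t < u (Suc j)"
      using not_less_Least[of j "\<lambda>n. n \<ge> N \<and> t < u (Suc n)"] by (simp add: n_def)
    then show ?thesis
      using j by simp
  qed (use \<open>u N \<le> t\<close> in simp)
  then show thesis
    using that[OF n(1)] n(2) gap[of n] by simp
qed

theorem theorem3p5:
  fixes D :: "'x::{real_inner,banach} set"
    and A :: "real \<Rightarrow> 'x \<Rightarrow> 'x"
    and C :: "'x \<Rightarrow>\<^sub>L 'y::{real_inner,banach}"
    and T S Tinf :: "real \<Rightarrow> real \<Rightarrow> 'x \<Rightarrow>\<^sub>L 'x"
    and \<mu> r :: real
    and tn :: "nat \<Rightarrow> real"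
  assumes "subspace D" and "closure D = UNIV"
    and "\<And>t. 0 \<le> t \<Longrightarrow> generates_c0_semigroup D (A t)"
    and "stable_family D A"
    and "strongly_C1_family D A"
    and "generates_evolution_system D A T"
    and "0 \<le> \<mu>" and "weakly_detectable \<mu> D A C" and "\<mu> < r"
    and "generates_evolution_system D (\<lambda>t x. A t x - r *\<^sub>R adjoint C (C x)) S"
    and "incseq tn" and "\<And>n. 0 < tn n" and "filterlim tn at_top sequentially"
    and "evolution_system Tinf"
    and "\<And>\<tau>. 0 \<le> \<tau> \<Longrightarrow>
           uniform_limit {0..\<tau>} (\<lambda>n t. T (tn n + t) (tn n)) (\<lambda>t. Tinf t 0) sequentially"
  shows "(\<forall>\<epsilon>0. weakly_tendsto
            (\<lambda>n. orth_proj (observable_subspace Tinf C) (S (tn n) 0 \<epsilon>0)) 0 sequentially) \<and>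
         (bounded (range (\<lambda>n. tn (Suc n) - tn n)) \<and> observable_subspace Tinf C = UNIV \<longrightarrow>
            (\<forall>\<epsilon>0. weakly_tendsto (\<lambda>t. S t 0 \<epsilon>0) 0 at_top))"
proof -
  note dense = assms(2) and gen = assms(3) and T = assms(6) and wd = assms(8) and S = assms(10)
    and U = assms(14) and lim = assms(15)
  have tn: "0 \<le> tn n" for n
    using assms(12) by (rule less_imp_le)
  define k where "k = \<mu> * (norm C)\<^sup>2"
  have "0 \<le> k"
    using \<open>0 \<le> \<mu>\<close> by (simp add: k_def)
  have T_ev: "evolution_system T" and S_ev: "evolution_system S"
    using T S by (simp_all add: generates_evolution_system_def)
  have T_growth: "norm (T t s x) \<le> exp (k * (t - s)) * norm x" if "0 \<le> s" "s \<le> t" for s t x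
    unfolding k_def by (rule detectable_evolution_growth[OF wd \<open>0 \<le> \<mu>\<close> dense T that])
  have adj_cont: "continuous_on {0..\<tau>} (\<lambda>t. adjoint (Tinf t 0) v)" for \<tau> v
    by (rule limit_evolution_adjoint_continuous[where T = T and U = Tinf and tn = tn and k = k,
          OF lim T_growth T_ev \<open>0 \<le> k\<close> tn])
  have gram_cont: "continuous_on {0..\<tau>} (\<lambda>t. adjoint (Tinf t 0) (adjoint C (C (Tinf t 0 z))))"
    for \<tau> z
  proof (rule gramian_integrand_continuous[OF adj_cont _ _ U])
    fix t x
    assume t: "t \<in> {0..\<tau>}"
    have "norm (Tinf t 0 x) \<le> exp (k * t) * norm x"
      using t by (intro limit_evolution_growth[where T = T and U = Tinf and tn = tn and k = k, OF lim T_growth tn]) auto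
    also have "\<dots> \<le> exp (k * \<tau>) * norm x"
      using t \<open>0 \<le> k\<close> by (intro mult_right_mono) (auto intro: mult_left_mono)
    finally show "norm (Tinf t 0 x) \<le> exp (k * \<tau>) * norm x" .
  qed simp
  have close: "uniform_limit {0..L} (\<lambda>n s. S (tn n + s) 0 x - Tinf s 0 (S (tn n) 0 x)) (\<lambda>_. 0)
      sequentially" if "x \<in> D" "0 \<le> L" for x L
    by (rule observer_error_follows_limit_evolution[where T = T and U = Tinf and tn = tn, OF wd \<open>0 \<le> \<mu>\<close> \<open>\<mu> < r\<close> dense gen T S that
          lim[OF that(2)] assms(13) tn])
  have gramian_null: "(\<lambda>n. S (tn n) 0 x \<bullet> obs_gramian Tinf C \<tau> z) \<longlonglongrightarrow> 0"
    if "x \<in> D" "0 \<le> \<tau>" for x \<tau> z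
  proof (rule output_small_implies_gramian_null[OF gram_cont U that(2) _ close[OF that]])
    show "continuous_on {0..\<tau>} (\<lambda>s. S (tn n + s) 0 x)" for n
      by (rule continuous_on_compose2[OF evolution_continuous_first[OF S_ev order_refl]])
        (use tn[of n] in \<open>auto intro!: continuous_intros\<close>)
    have "(\<lambda>n. integral {tn n..tn n + \<tau>} (\<lambda>\<sigma>. (norm (C (S \<sigma> 0 x)))\<^sup>2)) \<longlonglongrightarrow> 0"
      by (rule filterlim_compose[OF observer_output_energy_vanishes[OF wd \<open>\<mu> < r\<close> S that] assms(13)])
    moreover have "integral {0..\<tau>} (\<lambda>s. (norm (C (S (tn n + s) 0 x)))\<^sup>2)
        = integral {tn n..tn n + \<tau>} (\<lambda>\<sigma>. (norm (C (S \<sigma> 0 x)))\<^sup>2)" for n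
      using integral_shift_Icc_real[of 0 \<tau> "\<lambda>\<sigma>. (norm (C (S \<sigma> 0 x)))\<^sup>2" "tn n"]
      by (simp add: comp_def add.commute)
    ultimately show "(\<lambda>n. integral {0..\<tau>} (\<lambda>s. (norm (C (S (tn n + s) 0 x)))\<^sup>2)) \<longlonglongrightarrow> 0"
      by simp
  qed
  have null_D: "(\<lambda>n. S (tn n) 0 x \<bullet> v) \<longlonglongrightarrow> 0"
    if "x \<in> D" and v: "v \<in> observable_subspace Tinf C" for x v
  proof -
    have lin: "linear (\<lambda>v. S (tn n) 0 x \<bullet> v)" for n
      by (intro linearI) (simp_all add: inner_add_right)
    have bound: "\<forall>\<^sub>F n in sequentially. \<forall>v. \<bar>S (tn n) 0 x \<bullet> v\<bar> \<le> norm x * norm v"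
    proof (intro always_eventually allI)
      fix n v
      have "\<bar>S (tn n) 0 x \<bullet> v\<bar> \<le> norm (S (tn n) 0 x) * norm v"
        by (rule Cauchy_Schwarz_ineq2)
      also have "\<dots> \<le> norm x * norm v"
        by (intro mult_right_mono observer_error_contraction[OF wd \<open>\<mu> < r\<close> dense S tn]) simp
      finally show "\<bar>S (tn n) 0 x \<bullet> v\<bar> \<le> norm x * norm v" .
    qed
    let ?P = "\<Union>\<tau>\<in>{0<..}. orthogonal_comp {z. obs_gramian Tinf C \<tau> z = 0}"
    show ?thesis
    proof (rule null_functionals_on_closure_span[OF lin bound])
      show "v \<in> closure (span ?P)"
        using v closure_mono[OF span_superset[of ?P]] by (auto simp: observable_subspace_def)
    next
      fix w
      assume "w \<in> ?P"
      then obtain \<tau> where "0 < \<tau>" and "w \<in> orthogonal_comp {z. obs_gramian Tinf C \<tau> z = 0}"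
        by auto
      then have "w \<in> closure (span (range (obs_gramian Tinf C \<tau>)))"
        using orthogonal_comp_gramian_kernel_subset[OF gram_cont U] by blast
      moreover have "(\<lambda>n. S (tn n) 0 x \<bullet> g) \<longlonglongrightarrow> 0" if "g \<in> range (obs_gramian Tinf C \<tau>)" for g
        using gramian_null[OF \<open>x \<in> D\<close>] \<open>0 < \<tau>\<close> that by auto
      ultimately show "(\<lambda>n. S (tn n) 0 x \<bullet> w) \<longlonglongrightarrow> 0"
        by (rule null_functionals_on_closure_span[OF lin bound, rotated])
    qed
  qed
  have null: "(\<lambda>n. S (tn n) 0 \<epsilon>0 \<bullet> v) \<longlonglongrightarrow> 0" if "v \<in> observable_subspace Tinf C" for \<epsilon>0 v
    by (rule observer_error_null_of_dense[OF wd \<open>\<mu> < r\<close> dense S always_eventually null_D])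
      (use tn that in auto)
  have O_closed: "closed (observable_subspace Tinf C)"
    by (simp add: observable_subspace_def)
  have O_subspace: "subspace (observable_subspace Tinf C)"
    by (rule observable_subspace_subspace[OF gram_cont U])

  have "weakly_tendsto (\<lambda>n. orth_proj (observable_subspace Tinf C) (S (tn n) 0 \<epsilon>0)) 0 sequentially"
    for \<epsilon>0
    unfolding weakly_tendsto_0_iff
  proof
    fix u
    obtain p where p: "p \<in> observable_subspace Tinf C"
        "u - p \<in> orthogonal_comp (observable_subspace Tinf C)"
      using orthogonal_decomposition[OF O_subspace O_closed] by blast
    show "(\<lambda>n. orth_proj (observable_subspace Tinf C) (S (tn n) 0 \<epsilon>0) \<bullet> u) \<longlonglongrightarrow> 0"
      using null[OF p(1)] by (simp add: inner_orth_proj[OF O_subspace O_closed p])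
  qed
  moreover have "weakly_tendsto (\<lambda>t. S t 0 \<epsilon>0) 0 at_top"
    if gaps: "bounded (range (\<lambda>n. tn (Suc n) - tn n))" and full: "observable_subspace Tinf C = UNIV"
    for \<epsilon>0
    unfolding weakly_tendsto_0_iff
  proof
    fix v
    obtain L where "0 < L" and L: "\<And>n. tn (Suc n) - tn n \<le> L"
      using gaps unfolding bounded_pos by (auto simp: abs_le_iff)
    show "((\<lambda>t. S t 0 \<epsilon>0 \<bullet> v) \<longlongrightarrow> 0) at_top"
    proof (rule observer_error_null_of_dense[OF wd \<open>\<mu> < r\<close> dense S eventually_ge_at_top])
      fix x
      assume "x \<in> D"
      \<comment> \<open>Between two sampling times \<open>Tinf s 0\<close> acts for a variable time \<open>s\<close>. Moved to the test vector, it
        leaves the compact set \<open>?K\<close>, on which the weak convergence at the sampling times is uniform.\<close>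
      let ?K = "(\<lambda>s. adjoint (Tinf s 0) v) ` {0..L}"
      have "compact ?K"
        by (intro compact_continuous_image adj_cont compact_Icc)
      then have unif: "uniform_limit ?K (\<lambda>n w. S (tn n) 0 x \<bullet> w) (\<lambda>_. 0) sequentially"
        by (rule weak_null_uniform_on_compact[where B = "norm x"])
          (auto intro: observer_error_contraction[OF wd \<open>\<mu> < r\<close> dense S tn] null simp: full)
      show "((\<lambda>t. S t 0 x \<bullet> v) \<longlongrightarrow> 0) at_top"
        unfolding tendsto_iff
      proof (intro allI impI)
        fix e :: real
        assume "0 < e"
        then have e1: "0 < e / 2 / (norm v + 1)" and e2: "0 < e / 2"
          by (simp_all add: add_nonneg_pos)
        have "\<forall>\<^sub>F n in sequentially. \<forall>s\<in>{0..L}. \<bar>S (tn n + s) 0 x \<bullet> v\<bar> < e"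
          using uniform_limitD[OF close[OF \<open>x \<in> D\<close> less_imp_le[OF \<open>0 < L\<close>]] e1]
            uniform_limitD[OF unif e2]
        proof (eventually_elim, intro ballI)
          fix n s
          assume near: "\<forall>s\<in>{0..L}. dist (S (tn n + s) 0 x - Tinf s 0 (S (tn n) 0 x)) 0
                < e / 2 / (norm v + 1)"
            and small: "\<forall>w\<in>?K. dist (S (tn n) 0 x \<bullet> w) 0 < e / 2" and s: "s \<in> {0..L}"
          let ?d = "S (tn n + s) 0 x - Tinf s 0 (S (tn n) 0 x)"
          have "\<bar>?d \<bullet> v\<bar> \<le> norm ?d * norm v"
            by (rule Cauchy_Schwarz_ineq2)
          also have "\<dots> \<le> e / 2 / (norm v + 1) * (norm v + 1)"
            using near s e1 by (intro mult_mono) (auto intro: less_imp_le)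
          also have "\<dots> = e / 2"
            using norm_ge_zero[of v] by (intro nonzero_eq_divide_eq[THEN iffD1]) linarith+
          finally have "\<bar>S (tn n + s) 0 x \<bullet> v - Tinf s 0 (S (tn n) 0 x) \<bullet> v\<bar> \<le> e / 2"
            by (simp add: inner_diff_left)
          moreover have "\<bar>Tinf s 0 (S (tn n) 0 x) \<bullet> v\<bar> < e / 2"
            using small s by (simp add: inner_adjoint[symmetric])
          ultimately show "\<bar>S (tn n + s) 0 x \<bullet> v\<bar> < e"
            by linarith
        qed
        then obtain N where N: "\<And>n s. n \<ge> N \<Longrightarrow> s \<in> {0..L} \<Longrightarrow> \<bar>S (tn n + s) 0 x \<bullet> v\<bar> < e"
          unfolding eventually_sequentially by blast
        have "dist (S t 0 x \<bullet> v) 0 < e" if t: "tn N \<le> t" for t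
        proof -
          obtain n where "n \<ge> N" "t - tn n \<in> {0..L}"
            using bounded_gaps_cover[OF assms(11,13) L t] .
          from N[OF this] show ?thesis
            by simp
        qed
        then show "\<forall>\<^sub>F t in at_top. dist (S t 0 x \<bullet> v) 0 < e"
          using eventually_at_top_linorder by blast
      qed
    qed
  qed
  ultimately show ?thesis
    by blast
qed

end
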